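(* Let $T>0$, $K>0$, and consider the one-stock sub-diffusive market described in the context. The value process $V_t$ for the European call option with strike $K$ and maturity $T$, given, conditioning on $(\mathcal S_t,R_t)=(x,\tilde a)$, by $$V_t=e^{-r(T-t)}\int_0^\infty\mathbb E\Big[\big(x\exp\big(r(T-t)-\sigma^2y/2+\sigma\sqrt y\,Z\big)-K\big)^+\Big]\,\mathbb P\big(L_{(T-t-\tilde a)^+}\in dy\big)$$ with $Z$ a standard normal random variable, is given by $$V_t=e^{-r(T-t)}\,u\big(T-t,\ e^{r(T-t)}\mathcal S_t,\ R_t\big)\quad\text{for }t\in[0,T],$$ where for each $a\in[0,T)$, $(t,x)\mapsto u(t,x,a)$ is the unique solution to the following time-fractional PDE (with $x>0$): $$\begin{cases}\big(\kappa\frac{\partial}{\partial t}+\partial^w_t\big)u(t,x,a)=\frac12\sigma^2x^2\frac{\partial^2}{\partial x^2}u(t,x,a)&\text{for }t>a,\\ u(t,x,a)=(x-K)^+&\text{for }t\in[0,a].\end{cases}$$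
   Context: Let $B$ be a one-dimensional standard Brownian motion starting from $0$ on $(\Omega,\mathcal F,\mathbb P)$, and $S$ a subordinator (non-negative real-valued Lévy process with $S_0=0$) independent of $B$, with drift $\kappa\ge0$ and Lévy measure $\nu$: $\mathbb E[e^{-\lambda S_t}]=e^{-t\phi(\lambda)}$, $\phi(\lambda)=\kappa\lambda+\int_0^\infty(1-e^{-\lambda x})\nu(dx)$. $S$ is assumed strictly increasing a.s. (i.e. $\kappa>0$ or $\nu$ infinite, or both). Let $L_t:=\inf\{r\ge0:S_r>t\}$ be its (continuous) inverse, and let $R_t=R_0+S_{L_{(t-R_0)^+}}-t$ be the overshoot process, with deterministic initial wake-up time $R_0\in[0,T)$. Market: constant interest rate $r$ and stock price $d\mathcal S_t=\mathcal S_t\big(r\,dt+\bar\mu\,dL_{(t-R_0)^+}+\sigma\,dB_{L_{(t-R_0)^+}}\big)$, $\mathcal S_0>0$, with $r,\bar\mu,\sigma$ constants, $\sigma>0$. Time-fractional derivative: $w(x):=\nu([x,\infty))$ for $x>0$, and $\partial^w_tf(t):=\frac{d}{dt}\int_0^tw(s)(f(t-s)-f(0))\,ds$, $t>0$, whenever the derivative exists. Notion of solution, formulated for the initial-value problem $(\kappa\partial_t+\partial^w_t)u=\frac12\sigma^2x^2\partial_x^2u$ for $t>0$, $x>0$, with $u(0,x)=\psi(x)$ for $x>0$: a function $u(t,x)$ is a solution if there is some $\lambda_0\ge0$ such that for every $\lambda>\lambda_0$ the Laplace transform $\bar u(\lambda,x)=\int_0^\infty e^{-\lambda t}u(t,x)\,dt$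 exists for all $x>0$, and $x\mapsto\bar u(\lambda,x)$ has at most linear growth and is a weak solution of $$\tfrac12\sigma^2x^2\partial_x^2\bar u(\lambda,x)-\phi(\lambda)\bar u(\lambda,x)+\phi(\lambda)\psi(x)=0,\quad x>0 .$$ (A function on $[0,\infty)$ is regarded as uniquely characterized by its Laplace transform.)
   Formalization: In the definition of solution, the source term φ(λ)ψ(x) of the Laplace-transformed equation is corrected to (φ(λ)/λ)ψ(x); with the term as printed, no function solves the problem for ψ(x)=(x-K)^+. *)

theory Defs
  imports "HOL-Probability.Probability"
begin

section \<open>Brownian motion and subordinators\<close>

text \<open>
  Processes have type \<open>real \<Rightarrow> 'a \<Rightarrow> real\<close>; only times \<open>t \<ge> 0\<close> matter. Path regularity is
  required for every sample point, so that the inverse of the subordinator and the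
  time-changed Brownian motion are random variables without completing the probability space.
\<close>

definition indep_increments :: "'a measure \<Rightarrow> (real \<Rightarrow> 'a \<Rightarrow> real) \<Rightarrow> bool" where
  "indep_increments M X \<longleftrightarrow>
     (\<forall>n (\<tau> :: nat \<Rightarrow> real). 0 \<le> \<tau> 0 \<and> (\<forall>i<n. \<tau> i \<le> \<tau> (Suc i)) \<longrightarrow>
        prob_space.indep_vars M (\<lambda>_. borel)
          (\<lambda>i \<omega>. X (\<tau> (Suc i)) \<omega> - X (\<tau> i) \<omega>) {..<n})"

definition brownian_motion :: "'a measure \<Rightarrow> (real \<Rightarrow> 'a \<Rightarrow> real) \<Rightarrow> bool" where
  "brownian_motion M B \<longleftrightarrow>
     (\<forall>t\<ge>0. B t \<in> borel_measurable M) \<and>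
     (\<forall>\<omega>\<in>space M. B 0 \<omega> = 0 \<and> continuous_on {0..} (\<lambda>t. B t \<omega>)) \<and>
     indep_increments M B \<and>
     (\<forall>s t. 0 \<le> s \<and> s < t \<longrightarrow>
        distributed M lborel (\<lambda>\<omega>. B t \<omega> - B s \<omega>) (normal_density 0 (sqrt (t - s))))"

definition levy_process :: "'a measure \<Rightarrow> (real \<Rightarrow> 'a \<Rightarrow> real) \<Rightarrow> bool" where
  "levy_process M X \<longleftrightarrow>
     (\<forall>t\<ge>0. X t \<in> borel_measurable M) \<and>
     (\<forall>\<omega>\<in>space M. X 0 \<omega> = 0 \<and>
        (\<forall>t\<ge>0. continuous (at_right t) (\<lambda>s. X s \<omega>)) \<and>
        (\<forall>t>0. \<exists>l. ((\<lambda>s. X s \<omega>) \<longlongrightarrow> l) (at_left t))) \<and>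
     indep_increments M X \<and>
     (\<forall>s\<ge>0. \<forall>h\<ge>0. distr M borel (\<lambda>\<omega>. X (s + h) \<omega> - X s \<omega>) = distr M borel (X h))"

definition subordinator_levy_measure :: "real measure \<Rightarrow> bool" where
  "subordinator_levy_measure \<nu> \<longleftrightarrow>
     sets \<nu> = sets borel \<and> emeasure \<nu> {..0} = 0 \<and> (\<integral>\<^sup>+x. ennreal (min 1 x) \<partial>\<nu>) < \<infinity>"

definition laplace_exponent :: "real \<Rightarrow> real measure \<Rightarrow> real \<Rightarrow> real" where
  "laplace_exponent \<kappa> \<nu> l = \<kappa> * l + (LINT x:{0<..}|\<nu>. 1 - exp (- (l * x)))"

definition subordinator ::
    "'a measure \<Rightarrow> (real \<Rightarrow> 'a \<Rightarrow> real) \<Rightarrow> real \<Rightarrow> real measure \<Rightarrow> bool" where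
  "subordinator M S \<kappa> \<nu> \<longleftrightarrow>
     levy_process M S \<and> (\<forall>t\<ge>0. \<forall>\<omega>\<in>space M. 0 \<le> S t \<omega>) \<and>
     0 \<le> \<kappa> \<and> subordinator_levy_measure \<nu> \<and>
     (\<forall>t\<ge>0. \<forall>l\<ge>0. (LINT \<omega>|M. exp (- (l * S t \<omega>))) = exp (- (t * laplace_exponent \<kappa> \<nu> l)))"

definition indep_processes ::
    "'a measure \<Rightarrow> (real \<Rightarrow> 'a \<Rightarrow> real) \<Rightarrow> (real \<Rightarrow> 'a \<Rightarrow> real) \<Rightarrow> bool" where
  "indep_processes M X Y \<longleftrightarrow>
     prob_space.indep_var M
       (Pi\<^sub>M {0..} (\<lambda>_. borel)) (\<lambda>\<omega>. \<lambda>t\<in>{0..}. X t \<omega>)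
       (Pi\<^sub>M {0..} (\<lambda>_. borel)) (\<lambda>\<omega>. \<lambda>t\<in>{0..}. Y t \<omega>)"

definition inverse_process :: "(real \<Rightarrow> 'a \<Rightarrow> real) \<Rightarrow> real \<Rightarrow> 'a \<Rightarrow> real" where
  "inverse_process S t \<omega> = Inf {s. 0 \<le> s \<and> t < S s \<omega>}"

definition delayed_clock :: "(real \<Rightarrow> 'a \<Rightarrow> real) \<Rightarrow> real \<Rightarrow> real \<Rightarrow> 'a \<Rightarrow> real" where
  "delayed_clock S R0 t \<omega> = inverse_process S (max 0 (t - R0)) \<omega>"

definition overshoot :: "(real \<Rightarrow> 'a \<Rightarrow> real) \<Rightarrow> real \<Rightarrow> real \<Rightarrow> 'a \<Rightarrow> real" where
  "overshoot S R0 t \<omega> = R0 + S (delayed_clock S R0 t \<omega>) \<omega> - t"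


section \<open>The stock price equation\<close>

text \<open>
  The integral over \<open>[0, t]\<close> of a continuous adapted process \<open>H\<close> against a continuous
  semimartingale \<open>X\<close>: the limit in probability of the left-endpoint sums as the mesh tends to 0.
  For such processes this is the Ito integral; when \<open>X\<close> has finite variation it is the pathwise
  Stieltjes integral.
\<close>

definition has_stochastic_integral ::
    "'a measure \<Rightarrow> (real \<Rightarrow> 'a \<Rightarrow> real) \<Rightarrow> (real \<Rightarrow> 'a \<Rightarrow> real) \<Rightarrow> real \<Rightarrow> ('a \<Rightarrow> real) \<Rightarrow> bool"
  where
  "has_stochastic_integral M H X t J \<longleftrightarrow>
     J \<in> borel_measurable M \<and>
     (\<forall>\<epsilon>>0. \<exists>\<delta>>0. \<forall>n (\<tau> :: nat \<Rightarrow> real).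
        \<tau> 0 = 0 \<and> \<tau> n = t \<and> (\<forall>i<n. \<tau> i \<le> \<tau> (Suc i) \<and> \<tau> (Suc i) - \<tau> i < \<delta>) \<longrightarrow>
        measure M {\<omega> \<in> space M.
          \<bar>(\<Sum>i<n. H (\<tau> i) \<omega> * (X (\<tau> (Suc i)) \<omega> - X (\<tau> i) \<omega>)) - J \<omega>\<bar> > \<epsilon>} < \<epsilon>)"

text \<open>
  Adaptedness to the completed natural filtration of a pair of processes, in Doob--Dynkin form:
  up to a null set, \<open>H t\<close> is a measurable functional of the paths on \<open>[0, t]\<close>.
\<close>

definition adapted_to ::
    "'a measure \<Rightarrow> (real \<Rightarrow> 'a \<Rightarrow> real) \<Rightarrow> (real \<Rightarrow> 'a \<Rightarrow> real) \<Rightarrow> (real \<Rightarrow> 'a \<Rightarrow> real) \<Rightarrow> bool"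
  where
  "adapted_to M X Y H \<longleftrightarrow>
     (\<forall>t\<ge>0. H t \<in> borel_measurable M \<and>
        (\<exists>h \<in> borel_measurable (Pi\<^sub>M {0..t} (\<lambda>_. borel \<Otimes>\<^sub>M borel)).
           AE \<omega> in M. H t \<omega> = h (\<lambda>s\<in>{0..t}. (X s \<omega>, Y s \<omega>))))"

definition subdiffusive_stock ::
    "'a measure \<Rightarrow> (real \<Rightarrow> 'a \<Rightarrow> real) \<Rightarrow> (real \<Rightarrow> 'a \<Rightarrow> real) \<Rightarrow> real \<Rightarrow>
     real \<Rightarrow> real \<Rightarrow> real \<Rightarrow> real \<Rightarrow> (real \<Rightarrow> 'a \<Rightarrow> real) \<Rightarrow> bool" where
  "subdiffusive_stock M B S R0 r \<mu> \<sigma> s0 P \<longleftrightarrow>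
     (let A = delayed_clock S R0; W = (\<lambda>t \<omega>. B (A t \<omega>) \<omega>) in
        0 < s0 \<and>
        adapted_to M A W P \<and>
        (AE \<omega> in M. continuous_on {0..} (\<lambda>t. P t \<omega>)) \<and>
        (\<forall>t\<ge>0. \<exists>J1 J2.
           has_stochastic_integral M P A t J1 \<and> has_stochastic_integral M P W t J2 \<and>
           (AE \<omega> in M. P t \<omega> =
              s0 + r * (LINT s:{0..t}|lborel. P s \<omega>) + \<mu> * J1 \<omega> + \<sigma> * J2 \<omega>)))"


section \<open>Value of the European call\<close>

definition call_payoff :: "real \<Rightarrow> real \<Rightarrow> real" where
  "call_payoff K x = max 0 (x - K)"

definition call_value ::
    "'a measure \<Rightarrow> (real \<Rightarrow> 'a \<Rightarrow> real) \<Rightarrow> real \<Rightarrow> real \<Rightarrow> real \<Rightarrow> real \<Rightarrow>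
     real \<Rightarrow> real \<Rightarrow> real \<Rightarrow> real" where
  "call_value M S r \<sigma> K T t x a =
     exp (- (r * (T - t))) *
     (LINT y:{0..}|distr M borel (inverse_process S (max 0 (T - t - a))).
        (LINT z|density lborel std_normal_density.
           call_payoff K (x * exp (r * (T - t) - \<sigma>\<^sup>2 * y / 2 + \<sigma> * sqrt y * z))))"

definition value_process ::
    "'a measure \<Rightarrow> (real \<Rightarrow> 'a \<Rightarrow> real) \<Rightarrow> real \<Rightarrow> real \<Rightarrow> real \<Rightarrow> real \<Rightarrow> real \<Rightarrow>
     (real \<Rightarrow> 'a \<Rightarrow> real) \<Rightarrow> real \<Rightarrow> 'a \<Rightarrow> real" where
  "value_process M S R0 r \<sigma> K T P t \<omega> =
     call_value M S r \<sigma> K T t (P t \<omega>) (overshoot S R0 t \<omega>)"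


section \<open>Solutions of the time-fractional equation\<close>

definition laplace_transform_exists :: "(real \<Rightarrow> real) \<Rightarrow> real \<Rightarrow> bool" where
  "laplace_transform_exists f l \<longleftrightarrow> set_integrable lebesgue {0..} (\<lambda>t. exp (- (l * t)) * f t)"

definition laplace_transform :: "(real \<Rightarrow> real) \<Rightarrow> real \<Rightarrow> real" where
  "laplace_transform f l = (LINT t:{0..}|lebesgue. exp (- (l * t)) * f t)"

text \<open>Linear growth on \<open>(0, \<infinity>)\<close> includes boundedness near 0.\<close>

definition linear_growth :: "(real \<Rightarrow> real) \<Rightarrow> bool" where
  "linear_growth v \<longleftrightarrow> (\<exists>C. \<forall>x>0. \<bar>v x\<bar> \<le> C * (1 + x))"

text \<open>Continuously differentiable functions with compact support in \<open>(0, \<infinity>)\<close>.\<close>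

definition test_function :: "(real \<Rightarrow> real) \<Rightarrow> (real \<Rightarrow> real) \<Rightarrow> bool" where
  "test_function \<rho> \<rho>' \<longleftrightarrow>
     (\<forall>x. (\<rho> has_real_derivative \<rho>' x) (at x)) \<and> continuous_on UNIV \<rho>' \<and>
     (\<exists>p q. 0 < p \<and> (\<forall>x. x \<notin> {p..q} \<longrightarrow> \<rho> x = 0))"

text \<open>
  Weak solutions of \<open>\<sigma>\<^sup>2 x\<^sup>2 v'' / 2 - c v + f = 0\<close> on \<open>(0, \<infinity>)\<close> in the local Sobolev space of
  functions with locally square integrable weak derivative \<open>g\<close>. In dimension one such a
  function is (after the usual choice of representative) a primitive of \<open>g\<close>. The equation is
  tested with \<open>\<rho>\<close>, and one derivative is moved to \<open>x\<^sup>2 \<rho> x\<close>.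
\<close>

definition weak_solution :: "real \<Rightarrow> real \<Rightarrow> (real \<Rightarrow> real) \<Rightarrow> (real \<Rightarrow> real) \<Rightarrow> bool" where
  "weak_solution \<sigma> c f v \<longleftrightarrow>
     (\<exists>g. set_borel_measurable lborel {0<..} g \<and>
        (\<forall>p q. 0 < p \<and> p \<le> q \<longrightarrow>
           set_integrable lborel {p..q} (\<lambda>x. (g x)\<^sup>2) \<and>
           v q - v p = (LINT x:{p..q}|lborel. g x)) \<and>
        (\<forall>\<rho> \<rho>'. test_function \<rho> \<rho>' \<longrightarrow>
           (LINT x:{0<..}|lborel.
              - (\<sigma>\<^sup>2 / 2) * g x * (2 * x * \<rho> x + x\<^sup>2 * \<rho>' x) - c * v x * \<rho> x + f x * \<rho> x) = 0))"

text \<open>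
  The initial value problem \<open>(\<kappa> \<partial>\<^sub>t + \<partial>\<^sup>w\<^sub>t) u = \<sigma>\<^sup>2 x\<^sup>2 \<partial>\<^sub>x\<^sub>x u / 2\<close>, \<open>u 0 = \<psi>\<close>, is understood through
  the Laplace transform in time. Here \<open>w x = \<nu> [x, \<infinity>)\<close> and
  \<open>\<partial>\<^sup>w\<^sub>t f t = d/dt (\<integral>\<^sub>0\<^sup>t w s (f (t - s) - f 0) ds)\<close>. Since \<open>w\<close> has Laplace transform
  \<open>(laplace_exponent \<kappa> \<nu> l - \<kappa> l) / l\<close>, the transform of \<open>(\<kappa> \<partial>\<^sub>t + \<partial>\<^sup>w\<^sub>t) f\<close> at \<open>l\<close> is
  \<open>laplace_exponent \<kappa> \<nu> l * (laplace_transform f l - f 0 / l)\<close>. This is the source of the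
  factor \<open>1 / l\<close> in front of \<open>\<psi>\<close> (check: \<open>u = 1\<close> has to solve the problem with \<open>\<psi> = 1\<close>).
\<close>

definition ivp_solution ::
    "real \<Rightarrow> real measure \<Rightarrow> real \<Rightarrow> (real \<Rightarrow> real) \<Rightarrow> (real \<Rightarrow> real \<Rightarrow> real) \<Rightarrow> bool" where
  "ivp_solution \<kappa> \<nu> \<sigma> \<psi> u \<longleftrightarrow>
     (\<exists>l0\<ge>0. \<forall>l>l0.
        (\<forall>x>0. laplace_transform_exists (\<lambda>t. u t x) l) \<and>
        linear_growth (\<lambda>x. laplace_transform (\<lambda>t. u t x) l) \<and>
        weak_solution \<sigma> (laplace_exponent \<kappa> \<nu> l)
          (\<lambda>x. laplace_exponent \<kappa> \<nu> l / l * \<psi> x)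
          (\<lambda>x. laplace_transform (\<lambda>t. u t x) l))"

text \<open>
  The problem with \<open>u t x = \<psi> x\<close> for \<open>t \<in> [0, a]\<close> and the equation for \<open>t > a\<close>. As \<open>u\<close> is
  constant in time on \<open>[0, a]\<close>, for \<open>t > a\<close> the integrand defining \<open>\<partial>\<^sup>w\<^sub>t u t\<close> vanishes for
  \<open>s \<ge> t - a\<close>. Hence \<open>\<partial>\<^sup>w\<^sub>t u t\<close> is \<open>\<partial>\<^sup>w\<^sub>t\<close> of the shifted function \<open>\<lambda>t. u (t + a)\<close> at
  \<open>t - a\<close>, and the equation is the initial value problem for the shifted function.
\<close>

definition delayed_solution ::
    "real \<Rightarrow> real measure \<Rightarrow> real \<Rightarrow> (real \<Rightarrow> real) \<Rightarrow> real \<Rightarrow> (real \<Rightarrow> real \<Rightarrow> real) \<Rightarrow> bool" where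
  "delayed_solution \<kappa> \<nu> \<sigma> \<psi> a u \<longleftrightarrow>
     (\<forall>t\<in>{0..a}. \<forall>x>0. u t x = \<psi> x) \<and> ivp_solution \<kappa> \<nu> \<sigma> \<psi> (\<lambda>t x. u (t + a) x)"

text \<open>
  A Laplace transform determines a function up to Lebesgue-null sets of times, so uniqueness
  means equality at every \<open>x > 0\<close> for almost every \<open>t\<close>.
\<close>

definition unique_delayed_solution ::
    "real \<Rightarrow> real measure \<Rightarrow> real \<Rightarrow> (real \<Rightarrow> real) \<Rightarrow> real \<Rightarrow> (real \<Rightarrow> real \<Rightarrow> real) \<Rightarrow> bool" where
  "unique_delayed_solution \<kappa> \<nu> \<sigma> \<psi> a u \<longleftrightarrow>
     delayed_solution \<kappa> \<nu> \<sigma> \<psi> a u \<and>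
     (\<forall>v. delayed_solution \<kappa> \<nu> \<sigma> \<psi> a v \<longrightarrow>
        (\<forall>x>0. AE t in lebesgue. 0 \<le> t \<longrightarrow> v t x = u t x))"

end

theory Submission
  imports Defs
begin

text \<open>
  Write \<open>\<phi>\<close> for the Laplace exponent and \<open>L\<close> for the inverse of the subordinator. The solution is
  \<open>u t x a = E (C x (L (t - a)\<^sup>+))\<close>, where \<open>C x y\<close> is the Black--Scholes price, without interest, of
  the call when the operational time up to maturity is \<open>y\<close>. Moving the factor \<open>exp (r (T - t))\<close>
  into the initial price turns the value of the call into this expectation, so the content lies in
  solving the equation and in the uniqueness of the solution. Both happen after the Laplace
  transform in time, for one \<open>l > 0\<close> at a time.

  Existence. Up to the factor \<open>1 / l\<close>, the Laplace transform at \<open>l\<close> is an expectation at an independent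
  exponential time \<open>\<tau>\<close> of rate \<open>l\<close>. Up to null sets \<open>s < L \<tau>\<close> means \<open>S s < \<tau>\<close>, which has probability
  \<open>E (exp (- l S s)) = exp (- s \<phi> l)\<close>; so \<open>L \<tau>\<close> is exponential of rate \<open>\<phi> l\<close>
  (\<open>distr_inverse_process_exponential\<close>). At an exponential operational time the log-price has a
  two-sided exponential law (\<open>normal_mixture_asym_laplace\<close>, by comparing characteristic
  functions), with rates \<open>b\<close> and \<open>b - 1\<close> where \<open>b > 1\<close> solves \<open>\<sigma>\<^sup>2 / 2 b (b - 1) = \<phi> l\<close>. Therefore the
  transform of \<open>u\<close> is elementary: it is \<open>1 / l\<close> times the payoff plus a multiple of \<open>(x / K)\<^sup>b\<close> below
  and of \<open>(x / K)\<^sup>1\<^sup>-\<^sup>b\<close> above the strike (\<open>resolvent_call\<close>). The two branches fit together in a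
  continuously differentiable way, each solves the equation, and this gives a weak solution of
  linear growth.

  Uniqueness. The difference of two weak solutions solves the homogeneous Euler equation
  \<open>x\<^sup>2 d'' = b (b - 1) d\<close> weakly. The lemma of du Bois-Reymond makes it a classical solution, hence a
  combination of \<open>x\<^sup>b\<close> and \<open>x\<^sup>1\<^sup>-\<^sup>b\<close>. The first grows faster than linearly at infinity and the second is
  unbounded at 0, so linear growth leaves only \<open>d = 0\<close> (\<open>weak_solution_unique\<close>). Two
  solutions thus have the same Laplace transforms at each \<open>x\<close>, and Lerch's theorem
  (\<open>laplace_transform_unique\<close>) makes them equal at almost every time.
\<close>

section \<open>Exponential integrals and the exponential law\<close>

text \<open>
  The complex exponent is what the characteristic functions below require; the real integrals
  follow by taking real parts, and those over \<open>{..k}\<close> by reflection.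
\<close>

lemma has_bochner_integral_cexp_atLeast:
  fixes w :: complex and k :: real
  assumes "0 < Re w"
  shows "has_bochner_integral lborel (\<lambda>t. indicator {k..} t *\<^sub>R exp (- (w * of_real t)))
           (exp (- (w * of_real k)) / w)"
proof -
  let ?f = "\<lambda>t::real. exp (- (w * of_real t))"
  have w: "w \<noteq> 0" using assms by auto
  have int: "integrable lborel (\<lambda>t. indicator {k..} t *\<^sub>R ?f t)"
  proof (rule Bochner_Integration.integrable_bound)
    have "integrable lebesgue (\<lambda>t. indicator {k..} t *\<^sub>R exp (- Re w * t))"
      using assms
      by (intro nonnegative_absolutely_integrable_1 [unfolded set_integrable_def]
            integrable_on_exp_minus_to_infinity) auto
    then show "integrable lborel (\<lambda>t. indicator {k..} t *\<^sub>R exp (- Re w * t))"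
      by (subst (asm) integrable_completion) auto
  qed (auto simp: indicator_def)
  have "(LBINT t=ereal k..\<infinity>. ?f t) = 0 - (- exp (- (w * of_real k)) / w)"
  proof (rule interval_integral_FTC_integrable)
    show "((\<lambda>t. - ?f t / w) has_vector_derivative ?f t) (at t)" for t
      using w by (auto intro!: derivative_eq_intros has_vector_derivative_real_field
          simp: field_simps)
    have "set_integrable lborel {k..} ?f" using int by (simp add: set_integrable_def)
    then show "set_integrable lborel (einterval (ereal k) \<infinity>) ?f"
      by (rule set_integrable_subset) (auto simp: einterval_def)
    have "((\<lambda>t. - ?f t / w) \<longlongrightarrow> - exp (- (w * of_real k)) / w) (at_right k)"
      using w by (intro tendsto_intros) auto
    then show "(((\<lambda>t. - ?f t / w) \<circ> real_of_ereal) \<longlongrightarrow> - exp (- (w * of_real k)) / w)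
        (at_right (ereal k))"
      by (simp add: ereal_tendsto_simps)
    have "((\<lambda>t. exp (- (Re w * t))) \<longlongrightarrow> 0) at_top"
      using assms
      by (intro filterlim_compose[OF exp_at_bot] filterlim_compose[OF filterlim_uminus_at_bot_at_top]
          filterlim_tendsto_pos_mult_at_top[OF tendsto_const]) (auto intro: filterlim_ident)
    then have "((\<lambda>t. ?f t) \<longlongrightarrow> 0) at_top"
      by (subst tendsto_norm_zero_iff[symmetric]) simp
    from tendsto_divide[OF tendsto_minus[OF this] tendsto_const[of w] w]
    have "((\<lambda>t. - ?f t / w) \<longlongrightarrow> 0) at_top"
      by simp
    then show "(((\<lambda>t. - ?f t / w) \<circ> real_of_ereal) \<longlongrightarrow> 0) (at_left \<infinity>)"
      by (simp add: ereal_tendsto_simps)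
  qed auto
  also have "(LBINT t=ereal k..\<infinity>. ?f t) = (LBINT t:{k<..}. ?f t)"
    by (simp add: interval_lebesgue_integral_def einterval_def greaterThan_def)
  also have "\<dots> = (LBINT t:{k..}. ?f t)"
    unfolding set_lebesgue_integral_def
    by (intro integral_cong_AE) (use AE_lborel_singleton[of k] in \<open>auto simp: indicator_def elim!: eventually_mono\<close>)
  finally show ?thesis
    using int by (simp add: has_bochner_integral_iff set_lebesgue_integral_def)
qed

lemma has_bochner_integral_exp_atLeast:
  fixes a k :: real
  assumes "0 < a"
  shows "has_bochner_integral lborel (\<lambda>t. indicator {k..} t * exp (- (a * t))) (exp (- (a * k)) / a)"
proof -
  have "has_bochner_integral lborel
          (\<lambda>t. Re (indicator {k..} t *\<^sub>R exp (- (complex_of_real a * of_real t))))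
          (Re (exp (- (complex_of_real a * of_real k)) / of_real a))"
    using assms by (intro has_bochner_integral_Re has_bochner_integral_cexp_atLeast) simp
  moreover have "exp (- (complex_of_real a * of_real t)) = of_real (exp (- (a * t)))" for t
    by (simp add: exp_of_real[symmetric])
  ultimately show ?thesis
    by (simp flip: of_real_divide)
qed

lemma has_bochner_integral_exp_atMost:
  fixes a k :: real
  assumes "0 < a"
  shows "has_bochner_integral lborel (\<lambda>t. indicator {..k} t * exp (a * t)) (exp (a * k) / a)"
  using lborel_has_bochner_integral_real_affine_iff[of "-1" "\<lambda>t. indicator {..k} t * exp (a * t)"
      "exp (a * k) / a" 0] has_bochner_integral_exp_atLeast[OF assms, of "- k"]
  by (simp add: indicator_def le_minus_iff minus_le_iff)

lemma has_bochner_integral_cexp_atMost: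
  fixes w :: complex and k :: real
  assumes "0 < Re w"
  shows "has_bochner_integral lborel (\<lambda>t. indicator {..k} t *\<^sub>R exp (w * of_real t))
           (exp (w * of_real k) / w)"
  using lborel_has_bochner_integral_real_affine_iff[of "-1" "\<lambda>t. indicator {..k} t *\<^sub>R exp (w * of_real t)"
      "exp (w * of_real k) / w" 0] has_bochner_integral_cexp_atLeast[OF assms, of "- k"]
  by (simp add: indicator_def le_minus_iff minus_le_iff)

abbreviation exponential_distribution :: "real \<Rightarrow> real measure" where
  "exponential_distribution l \<equiv> density lborel (exponential_density l)"

lemma emeasure_exponential_distribution_greaterThan:
  assumes "0 < l" "0 \<le> s"
  shows "emeasure (exponential_distribution l) {s<..} = exp (- (l * s))"
proof -
  interpret E: prob_space "exponential_distribution l"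
    by (rule prob_space_exponential_density[OF assms(1)])
  have "E.prob {..s} = 1 - exp (- (l * s))"
    using emeasure_erlang_density[OF assms(1), of 0 s] assms
    by (simp add: measure_def erlang_CDF_0 mult.commute)
  moreover have "E.prob {s<..} = 1 - E.prob {..s}"
    using E.prob_compl[of "{..s}"] by (simp add: Compl_eq_Diff_UNIV[symmetric] Compl_atMost)
  ultimately show ?thesis by (simp add: E.emeasure_eq_measure)
qed

lemma AE_exponential_distribution_pos:
  assumes "0 < l"
  shows "AE t in exponential_distribution l. 0 < t"
  using AE_lborel_singleton[of "0::real"]
  by (subst AE_density) (auto simp: exponential_density_def elim!: eventually_mono)

section \<open>The log-price at an exponential operational time\<close>

text \<open>
  Since \<open>b\<close> and \<open>1 - b\<close> are the roots of \<open>s (s - 1) = b (b - 1)\<close>, this law has the moment generating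
  function \<open>b (b - 1) / (b (b - 1) - s (s - 1))\<close>. Up to a constant this is the resolvent of
  \<open>\<sigma>\<^sup>2 / 2 s (s - 1)\<close>, the exponent of the log-price \<open>\<sigma> B\<^sub>y - \<sigma>\<^sup>2 y / 2\<close>.
\<close>

definition asym_laplace_density :: "real \<Rightarrow> real \<Rightarrow> real" where
  "asym_laplace_density b z =
     b * (b - 1) / (2 * b - 1) * (if 0 \<le> z then exp (- (b * z)) else exp ((b - 1) * z))"

lemma borel_measurable_asym_laplace_density [measurable]:
  "asym_laplace_density b \<in> borel_measurable borel"
  unfolding asym_laplace_density_def by measurable

lemma asym_laplace_density_nonneg: "1 < b \<Longrightarrow> 0 \<le> asym_laplace_density b z"
  by (auto simp: asym_laplace_density_def)

text \<open>
  The two half-lines contribute \<open>1 / p\<close> and \<open>1 / q\<close> for \<open>p = b - \<i> \<theta>\<close> and \<open>q = b - 1 + \<i> \<theta>\<close>. Their sum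
  has the numerator \<open>p + q = 2 b - 1\<close>, which the normalising constant cancels.
\<close>

lemma has_bochner_integral_asym_laplace_cexp:
  assumes "1 < b"
  shows "has_bochner_integral lborel
           (\<lambda>z. asym_laplace_density b z *\<^sub>R exp (\<i> * of_real (\<theta> * z)))
           (of_real (b * (b - 1)) / (of_real (b * (b - 1)) + (of_real (\<theta>\<^sup>2) + \<i> * of_real \<theta>)))"
proof -
  let ?C = "b * (b - 1) / (2 * b - 1)"
  let ?p = "of_real b - \<i> * of_real \<theta> :: complex"
  let ?q = "of_real (b - 1) + \<i> * of_real \<theta> :: complex"
  have "has_bochner_integral lborel
      (\<lambda>z. ?C *\<^sub>R (indicator {0..} z *\<^sub>R exp (- (?p * of_real z))) +
           ?C *\<^sub>R (indicator {..0} z *\<^sub>R exp (?q * of_real z)))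
      (?C *\<^sub>R (exp (- (?p * of_real 0)) / ?p) + ?C *\<^sub>R (exp (?q * of_real 0) / ?q))"
    using assms
    by (intro has_bochner_integral_add has_bochner_integral_scaleR_right
        has_bochner_integral_cexp_atLeast has_bochner_integral_cexp_atMost) auto
  also have "?this \<longleftrightarrow> has_bochner_integral lborel
           (\<lambda>z. asym_laplace_density b z *\<^sub>R exp (\<i> * of_real (\<theta> * z)))
      (?C *\<^sub>R (exp (- (?p * of_real 0)) / ?p) + ?C *\<^sub>R (exp (?q * of_real 0) / ?q))"
  proof (rule has_bochner_integral_cong_AE)
    show "AE z in lborel. ?C *\<^sub>R (indicator {0..} z *\<^sub>R exp (- (?p * of_real z))) +
           ?C *\<^sub>R (indicator {..0} z *\<^sub>R exp (?q * of_real z)) =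
           asym_laplace_density b z *\<^sub>R exp (\<i> * of_real (\<theta> * z))"
      using AE_lborel_singleton[of 0]
    proof eventually_elim
      case (elim z)
      have 1: "exp (- (?p * of_real z)) = of_real (exp (- (b * z))) * exp (\<i> * of_real (\<theta> * z))"
        by (simp add: exp_of_real[symmetric] exp_add[symmetric] algebra_simps)
      have 2: "exp (?q * of_real z) = of_real (exp ((b - 1) * z)) * exp (\<i> * of_real (\<theta> * z))"
        by (simp add: exp_of_real[symmetric] exp_add[symmetric] algebra_simps)
      show ?case
        using elim unfolding 1 2 asym_laplace_density_def
        by (auto simp: indicator_def scaleR_conv_of_real)
    qed
  qed measurable
  also have "?C *\<^sub>R (exp (- (?p * of_real 0)) / ?p) + ?C *\<^sub>R (exp (?q * of_real 0) / ?q) =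
      of_real (b * (b - 1)) / (of_real (b * (b - 1)) + (of_real (\<theta>\<^sup>2) + \<i> * of_real \<theta>))"
  proof -
    have "Re ?p \<noteq> 0" "Re ?q \<noteq> 0" using assms by auto
    then have pq: "?p \<noteq> 0" "?q \<noteq> 0" by (metis zero_complex.sel(1))+
    have s: "?p + ?q = of_real (2 * b - 1)" by simp
    have m: "?p * ?q = of_real (b * (b - 1)) + (of_real (\<theta>\<^sup>2) + \<i> * of_real \<theta>)"
      by (simp add: algebra_simps power2_eq_square)
    have "?C *\<^sub>R (exp (- (?p * of_real 0)) / ?p) + ?C *\<^sub>R (exp (?q * of_real 0) / ?q) =
       of_real ?C * (1 / ?p + 1 / ?q)"
      by (simp add: scaleR_conv_of_real distrib_left)
    also have "1 / ?p + 1 / ?q = (?p + ?q) / (?p * ?q)"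
      using pq by (metis add.commute add_frac_eq mult_1)
    also have "of_real ?C * ((?p + ?q) / (?p * ?q)) = of_real ?C * (?p + ?q) / (?p * ?q)"
      by simp
    also have "\<dots> = (of_real ?C * of_real (2 * b - 1)) / (?p * ?q)"
      unfolding s ..
    also have "of_real ?C * of_real (2 * b - 1) = (of_real (?C * (2 * b - 1)) :: complex)"
      by (simp only: of_real_mult)
    also have "?C * (2 * b - 1) = b * (b - 1)" using assms by simp
    finally show ?thesis unfolding m .
  qed
  finally show ?thesis .
qed

lemma prob_space_asym_laplace:
  assumes "1 < b"
  shows "prob_space (density lborel (asym_laplace_density b))"
proof -
  have "has_bochner_integral lborel (\<lambda>z. Re (asym_laplace_density b z *\<^sub>R exp (\<i> * of_real (0 * z))))
      (Re (of_real (b * (b - 1)) / (of_real (b * (b - 1)) + (of_real (0\<^sup>2) + \<i> * of_real 0))))"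
    by (intro has_bochner_integral_Re has_bochner_integral_asym_laplace_cexp assms)
  then have "has_bochner_integral lborel (asym_laplace_density b) 1"
    using assms by (simp flip: of_real_diff of_real_mult of_real_divide)
  then have "(\<integral>\<^sup>+z. asym_laplace_density b z \<partial>lborel) = 1"
    using assms by (subst nn_integral_eq_integral)
      (auto simp: has_bochner_integral_iff asym_laplace_density_nonneg)
  then show ?thesis
    by (intro prob_spaceI) (simp add: emeasure_density)
qed

text \<open>
  Given \<open>y\<close>, the log-price is normal with mean \<open>- \<sigma>\<^sup>2 y / 2\<close> and variance \<open>\<sigma>\<^sup>2 y\<close>, so its characteristic
  function \<open>exp (- \<sigma>\<^sup>2 / 2 (\<theta>\<^sup>2 + \<i> \<theta>) y)\<close> is exponential in \<open>y\<close>. Integrating it against an exponential law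
  is elementary, and the result is the characteristic function of \<open>asym_laplace_density b\<close>.
\<close>

theorem normal_mixture_asym_laplace:
  assumes "1 < b" "0 < \<sigma>"
  defines "\<phi> \<equiv> \<sigma>\<^sup>2 / 2 * (b * (b - 1))"
  shows "distr (exponential_distribution \<phi> \<Otimes>\<^sub>M std_normal_distribution) borel
           (\<lambda>(y, z). - (\<sigma>\<^sup>2 * y / 2) + \<sigma> * sqrt y * z)
         = density lborel (asym_laplace_density b)" (is "distr ?Q borel ?Y = ?D")
proof (rule Levy_uniqueness)
  have \<phi>: "0 < \<phi>" using assms by simp
  interpret E: prob_space "exponential_distribution \<phi>"
    by (rule prob_space_exponential_density[OF \<phi>])
  interpret N: prob_space std_normal_distribution
    by (simp add: prob_space_normal_density)
  interpret Q: pair_prob_space "exponential_distribution \<phi>" std_normal_distribution ..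
  interpret D: prob_space ?D by (rule prob_space_asym_laplace[OF assms(1)])
  have Y [measurable]: "?Y \<in> borel_measurable ?Q" by measurable
  show "real_distribution (distr ?Q borel ?Y)" by (rule Q.real_distribution_distr) measurable
  show "real_distribution ?D" by standard auto
  show "char (distr ?Q borel ?Y) = char ?D"
  proof
    fix \<theta> :: real
    let ?w = "of_real \<phi> + of_real (\<sigma>\<^sup>2 / 2) * (of_real (\<theta>\<^sup>2) + \<i> * of_real \<theta>) :: complex"
    have "char (distr ?Q borel ?Y) \<theta> = (CLINT q|?Q. iexp (\<theta> * ?Y q))"
      unfolding char_def by (subst integral_distr) auto
    also have "\<dots> = (CLINT y|exponential_distribution \<phi>. CLINT z|std_normal_distribution.
                       iexp (\<theta> * (- (\<sigma>\<^sup>2 * y / 2) + \<sigma> * sqrt y * z)))"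
    proof -
      have "integrable ?Q (\<lambda>q. iexp (\<theta> * ?Y q))"
        by (rule Q.P.integrable_const_bound[where B=1]) (auto, measurable)
      from Q.integral_fst'[OF this] show ?thesis by simp
    qed
    also have "\<dots> = (CLINT y|exponential_distribution \<phi>.
        iexp (- (\<theta> * \<sigma>\<^sup>2 * y / 2)) * exp (- of_real ((\<theta> * \<sigma> * sqrt y)\<^sup>2 / 2)))"
    proof (rule Bochner_Integration.integral_cong[OF refl])
      fix y :: real
      have "(CLINT z|std_normal_distribution. iexp (\<theta> * (- (\<sigma>\<^sup>2 * y / 2) + \<sigma> * sqrt y * z))) =
          (CLINT z|std_normal_distribution. iexp (- (\<theta> * \<sigma>\<^sup>2 * y / 2)) * iexp ((\<theta> * \<sigma> * sqrt y) * z))"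
        by (intro Bochner_Integration.integral_cong refl)
           (simp add: exp_add[symmetric] algebra_simps)
      also have "\<dots> = iexp (- (\<theta> * \<sigma>\<^sup>2 * y / 2)) * char std_normal_distribution (\<theta> * \<sigma> * sqrt y)"
        unfolding char_def by (rule integral_mult_right_zero)
      also have "\<dots> = iexp (- (\<theta> * \<sigma>\<^sup>2 * y / 2)) * exp (- of_real ((\<theta> * \<sigma> * sqrt y)\<^sup>2 / 2))"
        by (simp add: char_std_normal_distribution exp_of_real[symmetric])
      finally show "(CLINT z|std_normal_distribution. iexp (\<theta> * (- (\<sigma>\<^sup>2 * y / 2) + \<sigma> * sqrt y * z))) =
          iexp (- (\<theta> * \<sigma>\<^sup>2 * y / 2)) * exp (- of_real ((\<theta> * \<sigma> * sqrt y)\<^sup>2 / 2))" .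
    qed
    also have "\<dots> = (CLINT y|lborel. exponential_density \<phi> y *\<^sub>R
        (iexp (- (\<theta> * \<sigma>\<^sup>2 * y / 2)) * exp (- of_real ((\<theta> * \<sigma> * sqrt y)\<^sup>2 / 2))))"
      using \<phi> by (subst integral_density) (auto simp: exponential_density_nonneg)
    also have "\<dots> = (CLINT y|lborel. of_real \<phi> * (indicator {0..} y *\<^sub>R exp (- (?w * of_real y))))"
    proof (rule Bochner_Integration.integral_cong[OF refl])
      fix y :: real
      show "exponential_density \<phi> y *\<^sub>R
        (iexp (- (\<theta> * \<sigma>\<^sup>2 * y / 2)) * exp (- of_real ((\<theta> * \<sigma> * sqrt y)\<^sup>2 / 2))) =
        of_real \<phi> * (indicator {0..} y *\<^sub>R exp (- (?w * of_real y)))"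
      proof (cases "0 \<le> y")
        case True
        have "of_real (exp (- y * \<phi>)) * (iexp (- (\<theta> * \<sigma>\<^sup>2 * y / 2)) * exp (- of_real ((\<theta> * \<sigma> * sqrt y)\<^sup>2 / 2)))
            = exp (\<i> * of_real (- (\<theta> * \<sigma>\<^sup>2 * y / 2)) - of_real ((\<theta> * \<sigma> * sqrt y)\<^sup>2 / 2) - of_real (y * \<phi>))"
          by (simp add: exp_of_real[symmetric] exp_add[symmetric])
        also have "\<i> * of_real (- (\<theta> * \<sigma>\<^sup>2 * y / 2)) - of_real ((\<theta> * \<sigma> * sqrt y)\<^sup>2 / 2) - of_real (y * \<phi>)
            = - (?w * of_real y)"
          using True by (simp add: power_mult_distrib algebra_simps flip: of_real_power)
        finally show ?thesis
          using True by (simp add: exponential_density_def scaleR_conv_of_real)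
      qed (simp add: exponential_density_def)
    qed
    also have "\<dots> = of_real \<phi> / ?w"
    proof -
      have "0 < Re ?w" using \<phi> by (simp add: add_pos_nonneg)
      from has_bochner_integral_cexp_atLeast[OF this, of 0]
      show ?thesis
        by (subst integral_mult_right_zero) (simp only: has_bochner_integral_iff, simp)
    qed
    also have "\<dots> = of_real (b * (b - 1)) / (of_real (b * (b - 1)) + (of_real (\<theta>\<^sup>2) + \<i> * of_real \<theta>))"
    proof -
      have *: "of_real \<phi> = of_real (\<sigma>\<^sup>2 / 2) * (of_real (b * (b - 1)) :: complex)"
        unfolding \<phi>_def by (simp only: of_real_mult)
      have "?w = of_real (\<sigma>\<^sup>2 / 2) * (of_real (b * (b - 1)) + (of_real (\<theta>\<^sup>2) + \<i> * of_real \<theta>))"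
        unfolding * by (rule distrib_left[symmetric])
      then show ?thesis unfolding * using assms(2) by simp
    qed
    also have "\<dots> = char ?D \<theta>"
      using has_bochner_integral_asym_laplace_cexp[OF assms(1), of \<theta>] assms(1)
      unfolding char_def
      by (subst integral_density) (auto simp: has_bochner_integral_iff asym_laplace_density_nonneg)
    finally show "char (distr ?Q borel ?Y) \<theta> = char ?D \<theta>" .
  qed
qed

section \<open>The inverse subordinator at an exponential time\<close>

locale strict_subordinator = prob_space M for M :: "'a measure" +
  fixes S :: "real \<Rightarrow> 'a \<Rightarrow> real" and \<kappa> :: real and \<nu> :: "real measure"
  assumes sub: "subordinator M S \<kappa> \<nu>"
    and strict: "AE \<omega> in M. strict_mono_on {0..} (\<lambda>t. S t \<omega>)"
begin

lemma measurable_S [measurable (raw)]: "0 \<le> t \<Longrightarrow> S t \<in> borel_measurable M"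
  using sub by (auto simp: subordinator_def levy_process_def)

lemma S_0: "\<omega> \<in> space M \<Longrightarrow> S 0 \<omega> = 0"
  and S_nonneg: "\<omega> \<in> space M \<Longrightarrow> 0 \<le> t \<Longrightarrow> 0 \<le> S t \<omega>"
  and S_right_continuous: "\<omega> \<in> space M \<Longrightarrow> 0 \<le> t \<Longrightarrow> continuous (at_right t) (\<lambda>s. S s \<omega>)"
  using sub by (auto simp: subordinator_def levy_process_def)

lemma laplace_transform_S:
  "0 \<le> t \<Longrightarrow> 0 \<le> l \<Longrightarrow>
     (LINT \<omega>|M. exp (- (l * S t \<omega>))) = exp (- (t * laplace_exponent \<kappa> \<nu> l))"
  using sub by (auto simp: subordinator_def)

lemma integrable_exp_S: "0 \<le> t \<Longrightarrow> 0 \<le> l \<Longrightarrow> integrable M (\<lambda>\<omega>. exp (- (l * S t \<omega>)))"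
  by (rule integrable_const_bound[where B = 1]) (auto simp: S_nonneg)

text \<open>
  Strict increase gives \<open>S 1 > 0\<close>, so \<open>exp (- l S 1)\<close> has an expectation below 1.
\<close>

lemma laplace_exponent_pos:
  assumes "0 < l"
  shows "0 < laplace_exponent \<kappa> \<nu> l"
proof -
  have "(LINT \<omega>|M. exp (- (l * S 1 \<omega>))) < (LINT \<omega>|M. 1)"
  proof (rule integral_less_AE_space)
    show "AE \<omega> in M. exp (- (l * S 1 \<omega>)) < 1"
      using strict AE_space
    proof eventually_elim
      case (elim \<omega>)
      have "S 0 \<omega> < S 1 \<omega>" by (rule strict_mono_onD[OF elim(1)]) auto
      with S_0[OF elim(2)] assms show ?case by simp
    qed
  qed (use assms in \<open>auto intro!: integrable_exp_S simp: emeasure_space_1\<close>)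
  then show ?thesis
    using assms by (simp add: laplace_transform_S prob_space)
qed

text \<open>
  Needed for the inverse to be finite: the infimum defining it is over a non-empty set only
  where the path exceeds \<open>t\<close>. The event that the path stays below \<open>c\<close> at all integers \<open>m\<close> has
  probability at most \<open>exp (c - m \<phi>)\<close> for every \<open>m\<close>, by Markov's inequality.
\<close>

lemma AE_S_unbounded: "AE \<omega> in M. \<forall>t. \<exists>s\<ge>0. t < S s \<omega>"
proof -
  let ?\<phi> = "laplace_exponent \<kappa> \<nu> 1"
  have "AE \<omega> in M. \<exists>m::nat. real c < S (real m) \<omega>" for c :: nat
  proof -
    let ?A = "{\<omega> \<in> space M. \<forall>m::nat. S (real m) \<omega> \<le> real c}"
    have A: "?A \<in> sets M" by measurable
    have "prob ?A * exp (- real c) \<le> exp (- (real m * ?\<phi>))" for m :: nat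
    proof -
      have "prob ?A * exp (- real c) = (LINT \<omega>|M. indicator ?A \<omega> * exp (- real c))"
        using A by simp
      also have "\<dots> \<le> (LINT \<omega>|M. exp (- (1 * S (real m) \<omega>)))"
      proof (rule integral_mono)
        show "integrable M (\<lambda>\<omega>. indicator ?A \<omega> * exp (- real c))"
          using A by (intro integrable_mult_left integrable_real_indicator)
            (auto simp: emeasure_eq_measure)
        show "integrable M (\<lambda>\<omega>. exp (- (1 * S (real m) \<omega>)))" by (rule integrable_exp_S) auto
      qed (auto simp: indicator_def)
      also have "\<dots> = exp (- (real m * ?\<phi>))"
        by (subst laplace_transform_S) auto
      finally show ?thesis .
    qed
    moreover have "(\<lambda>m. exp (- (real m * ?\<phi>))) \<longlonglongrightarrow> 0"
    proof -
      have "(\<lambda>m. exp (- ?\<phi>) ^ m) \<longlonglongrightarrow> 0"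
        using laplace_exponent_pos[of 1] by (intro LIMSEQ_realpow_zero) auto
      then show ?thesis by (simp add: exp_of_nat_mult[symmetric])
    qed
    ultimately have "prob ?A * exp (- real c) \<le> 0"
      by (intro LIMSEQ_le_const) auto
    then have "prob ?A = 0"
      by (simp add: mult_le_0_iff measure_le_0_iff)
    then have "AE \<omega> in M. \<omega> \<notin> ?A"
      using A by (subst AE_iff_measurable[of ?A]) (auto simp: emeasure_eq_measure)
    then show ?thesis by (auto simp: not_le)
  qed
  then have "AE \<omega> in M. \<forall>c. \<exists>m::nat. real c < S (real m) \<omega>"
    by (simp add: AE_all_countable)
  then show ?thesis
  proof eventually_elim
    case (elim \<omega>)
    show ?case
    proof
      fix t :: real
      obtain c :: nat where "t \<le> real c" using real_arch_simple by blast
      moreover obtain m :: nat where "real c < S (real m) \<omega>" using elim by blast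
      ultimately show "\<exists>s\<ge>0. t < S s \<omega>" by (intro exI[of _ "real m"]) auto
    qed
  qed
qed

lemma less_inverse_process_imp:
  assumes "0 \<le> s" "s < inverse_process S t \<omega>"
  shows "S s \<omega> \<le> t"
proof (rule ccontr)
  assume "\<not> S s \<omega> \<le> t"
  then have "inverse_process S t \<omega> \<le> s"
    unfolding inverse_process_def using assms(1) by (intro cInf_lower) auto
  then show False using assms by simp
qed

text \<open>
  Right continuity makes the inequality strict: a path below \<open>t\<close> at \<open>s\<close> stays there for a while.
\<close>

lemma less_inverse_process:
  assumes \<omega>: "\<omega> \<in> space M" "strict_mono_on {0..} (\<lambda>t. S t \<omega>)" "\<forall>t. \<exists>s\<ge>0. t < S s \<omega>"
    and "0 \<le> s" "S s \<omega> < t"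
  shows "s < inverse_process S t \<omega>"
proof -
  have "((\<lambda>u. S u \<omega>) \<longlongrightarrow> S s \<omega>) (at_right s)"
    using S_right_continuous[OF \<omega>(1) \<open>0 \<le> s\<close>] by (simp add: continuous_within)
  then have "\<forall>\<^sub>F u in at_right s. S u \<omega> < t"
    using \<open>S s \<omega> < t\<close> by (rule order_tendstoD)
  then obtain u where u: "s < u" "S u \<omega> < t"
    by (metis (no_types, lifting) eventually_at_right_field gt_ex dense less_imp_le)
  have "u \<le> inverse_process S t \<omega>"
    unfolding inverse_process_def
  proof (rule cInf_greatest)
    show "{s. 0 \<le> s \<and> t < S s \<omega>} \<noteq> {}" using \<omega>(3) by auto
    fix v assume v: "v \<in> {s. 0 \<le> s \<and> t < S s \<omega>}"
    show "u \<le> v"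
    proof (rule ccontr)
      assume "\<not> u \<le> v"
      then have "S v \<omega> < S u \<omega>"
        using v u \<open>0 \<le> s\<close> by (intro strict_mono_onD[OF \<omega>(2)]) auto
      with u v show False by auto
    qed
  qed
  with u show ?thesis by simp
qed

lemma inverse_process_nonneg:
  assumes "\<exists>s\<ge>0. t < S s \<omega>"
  shows "0 \<le> inverse_process S t \<omega>"
  unfolding inverse_process_def using assms by (intro cInf_greatest) auto

lemma AE_inverse_process_0: "AE \<omega> in M. inverse_process S 0 \<omega> = 0"
  using strict AE_S_unbounded AE_space
proof eventually_elim
  case (elim \<omega>)
  have "\<not> 0 < inverse_process S 0 \<omega>"
  proof
    assume "0 < inverse_process S 0 \<omega>"
    then obtain s where s: "0 < s" "s < inverse_process S 0 \<omega>" using dense by blast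
    have "S 0 \<omega> < S s \<omega>" by (rule strict_mono_onD[OF elim(1)]) (use s in auto)
    with less_inverse_process_imp[of s 0 \<omega>] s S_0[OF elim(3)] show False by simp
  qed
  with inverse_process_nonneg[of 0 \<omega>] elim(2) show ?case by fastforce
qed

text \<open>
  By right continuity of the paths, the infimum defining the inverse can be taken over the
  rational times. The paths that never exceed \<open>t\<close> need a separate case, in which the inverse is
  the unspecified but constant value \<open>Inf {}\<close>.
\<close>

lemma measurable_inverse_process_pair [measurable]:
  "(\<lambda>(t, \<omega>). inverse_process S t \<omega>) \<in> borel_measurable (borel \<Otimes>\<^sub>M M)"
proof (rule borel_measurableI_less)
  fix c :: real
  define q where "q = (\<lambda>i::rat. \<bar>real_of_rat i\<bar>)"
  have q: "0 \<le> q i" for i by (simp add: q_def)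
  have dense: "\<exists>i. q i < d \<and> t < S (q i) \<omega>"
    if "\<omega> \<in> space M" "0 \<le> s" "s < d" "t < S s \<omega>" for t s d \<omega>
  proof -
    have "((\<lambda>u. S u \<omega>) \<longlongrightarrow> S s \<omega>) (at_right s)"
      using S_right_continuous[OF that(1,2)] by (simp add: continuous_within)
    then have "\<forall>\<^sub>F u in at_right s. t < S u \<omega>"
      using \<open>t < S s \<omega>\<close> by (rule order_tendstoD)
    then obtain b where b: "b > s" "\<And>u. s < u \<Longrightarrow> u < b \<Longrightarrow> t < S u \<omega>"
      by (auto simp: eventually_at_right_field)
    obtain i where i: "s < real_of_rat i" "real_of_rat i < min b d"
      using of_rat_dense[of s "min b d"] b(1) \<open>s < d\<close> by auto
    have "q i = real_of_rat i" unfolding q_def using i(1) \<open>0 \<le> s\<close> by linarith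
    then show ?thesis using b(2)[of "q i"] i by (intro exI[of _ i]) simp
  qed
  have less_iff: "inverse_process S t \<omega> < c \<longleftrightarrow>
      (\<exists>i. q i < c \<and> t < S (q i) \<omega>) \<or> ((\<forall>i. S (q i) \<omega> \<le> t) \<and> Inf {} < c)"
    if \<omega>: "\<omega> \<in> space M" for t \<omega>
  proof (cases "{s. 0 \<le> s \<and> t < S s \<omega>} = {}")
    case True
    then have le: "S (q i) \<omega> \<le> t" for i
      using q[of i] by (simp add: not_less)
    show ?thesis
      unfolding inverse_process_def True using le by (metis not_le)
  next
    case False
    then obtain s where s: "0 \<le> s" "t < S s \<omega>" by blast
    have "\<exists>i. q i < s + 1 \<and> t < S (q i) \<omega>"
      by (rule dense[OF \<omega> s(1) _ s(2)]) simp
    then obtain i where i: "t < S (q i) \<omega>" by (elim exE conjE)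
    then have nle: "\<not> (\<forall>i. S (q i) \<omega> \<le> t)" by (metis not_le)
    have bdd: "bdd_below {s. 0 \<le> s \<and> t < S s \<omega>}" by (rule bdd_belowI[of _ 0]) simp
    have "inverse_process S t \<omega> < c \<longleftrightarrow> (\<exists>i. q i < c \<and> t < S (q i) \<omega>)"
      unfolding inverse_process_def cInf_less_iff[OF False bdd]
    proof
      assume "\<exists>s\<in>{s. 0 \<le> s \<and> t < S s \<omega>}. s < c"
      then obtain s where s: "0 \<le> s" "t < S s \<omega>" "s < c" by blast
      show "\<exists>i. q i < c \<and> t < S (q i) \<omega>" by (rule dense[OF \<omega> s(1,3,2)])
    next
      assume "\<exists>i. q i < c \<and> t < S (q i) \<omega>"
      then obtain i where "q i < c" "t < S (q i) \<omega>" by blast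
      with q[of i] show "\<exists>s\<in>{s. 0 \<le> s \<and> t < S s \<omega>}. s < c" by blast
    qed
    with nle show ?thesis by (simp only: simp_thms)
  qed
  have [measurable]: "S (q i) \<in> borel_measurable M" for i
    by (rule measurable_S[OF q])
  have "{x \<in> space (borel \<Otimes>\<^sub>M M). (\<lambda>(t, \<omega>). inverse_process S t \<omega>) x < c} =
     {x \<in> space (borel \<Otimes>\<^sub>M M). (\<exists>i. q i < c \<and> fst x < S (q i) (snd x)) \<or>
        ((\<forall>i. S (q i) (snd x) \<le> fst x) \<and> Inf {} < c)}"
    by (rule Collect_cong) (simp add: space_pair_measure split_beta less_iff mem_Times_iff cong: conj_cong)
  also have "\<dots> \<in> sets (borel \<Otimes>\<^sub>M M)" by measurable
  finally show "{x \<in> space (borel \<Otimes>\<^sub>M M). (\<lambda>(t, \<omega>). inverse_process S t \<omega>) x < c} \<in> sets (borel \<Otimes>\<^sub>M M)" .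
qed

text \<open>
  For a fixed path and almost every \<open>t\<close>, the inverse exceeds \<open>s\<close> at \<open>t\<close> exactly if \<open>S s < t\<close>. An
  exponential time exceeds \<open>S s\<close> with probability \<open>exp (- l S s)\<close>, and the expectation of this is
  \<open>exp (- s \<phi>)\<close> by the definition of the Laplace exponent \<open>\<phi>\<close>.
\<close>

theorem distr_inverse_process_exponential:
  assumes l: "0 < l"
  shows "distr (exponential_distribution l \<Otimes>\<^sub>M M) borel (\<lambda>(t, \<omega>). inverse_process S t \<omega>)
       = exponential_distribution (laplace_exponent \<kappa> \<nu> l)" (is "distr ?P borel ?L = ?E")
proof (rule measure_eqI_lessThan)
  interpret E: prob_space "exponential_distribution l"
    by (rule prob_space_exponential_density[OF l])
  interpret P: pair_prob_space "exponential_distribution l" M ..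
  let ?\<phi> = "laplace_exponent \<kappa> \<nu> l"
  note \<phi> = laplace_exponent_pos[OF l]
  have [measurable]: "?L \<in> borel_measurable ?P"
    by measurable
  interpret D: prob_space "distr ?P borel ?L"
    by (rule P.P.prob_space_distr) measurable
  show "emeasure (distr ?P borel ?L) {s<..} < \<infinity>" for s
    by (simp add: D.emeasure_eq_measure)
  fix s :: real
  \<comment> \<open>Both laws live on \<open>[0, \<infinity>)\<close>, so a negative \<open>s\<close> may be replaced by 0.\<close>
  define s' where "s' = max 0 s"
  have s': "0 \<le> s'" by (simp add: s'_def)
  have "emeasure (distr ?P borel ?L) {s<..} = emeasure ?P {x \<in> space ?P. s < ?L x}"
    by (subst emeasure_distr) (auto intro!: arg_cong2[where f=emeasure])
  also have "\<dots> = (\<integral>\<^sup>+\<omega>. emeasure (exponential_distribution l) {t. s < inverse_process S t \<omega>} \<partial>M)"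
    by (subst P.emeasure_pair_measure_alt2)
       (measurable, auto intro!: nn_integral_cong arg_cong2[where f=emeasure] simp: space_pair_measure)
  also have "\<dots> = (\<integral>\<^sup>+\<omega>. ennreal (exp (- (l * S s' \<omega>))) \<partial>M)"
  proof (rule nn_integral_cong_AE)
    show "AE \<omega> in M. emeasure (exponential_distribution l) {t. s < inverse_process S t \<omega>} =
            ennreal (exp (- (l * S s' \<omega>)))"
      using strict AE_S_unbounded AE_space
    proof eventually_elim
      case (elim \<omega>)
      have "emeasure (exponential_distribution l) {t. s < inverse_process S t \<omega>} =
            emeasure (exponential_distribution l) {S s' \<omega><..}"
      proof (rule emeasure_eq_AE)
        have "AE t in exponential_distribution l. t \<noteq> S s' \<omega>"
          using AE_lborel_singleton[of "S s' \<omega>"] by (subst AE_density) auto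
        with AE_exponential_distribution_pos[OF l]
        show "AE t in exponential_distribution l.
            (t \<in> {t. s < inverse_process S t \<omega>}) = (t \<in> {S s' \<omega><..})"
        proof eventually_elim
          fix t assume t: "0 < t" "t \<noteq> S s' \<omega>"
          have "s < inverse_process S t \<omega> \<longleftrightarrow> S s' \<omega> < t"
          proof
            assume "S s' \<omega> < t"
            then have "s' < inverse_process S t \<omega>"
              using elim s' by (intro less_inverse_process) auto
            then show "s < inverse_process S t \<omega>" by (simp add: s'_def)
          next
            assume *: "s < inverse_process S t \<omega>"
            show "S s' \<omega> < t"
            proof (cases "0 \<le> s")
              case True
              then show ?thesis
                using less_inverse_process_imp[OF _ *] t by (simp add: s'_def)
            next
              case False
              then show ?thesis using t S_0 elim by (simp add: s'_def)
            qed
          qed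
          then show "(t \<in> {t. s < inverse_process S t \<omega>}) = (t \<in> {S s' \<omega><..})" by simp
        qed
        show "{t. s < inverse_process S t \<omega>} \<in> sets (exponential_distribution l)"
        proof -
          have [measurable]: "(\<lambda>t. inverse_process S t \<omega>) \<in> borel_measurable borel"
            using measurable_compose[OF measurable_Pair2'[of \<omega> M borel] measurable_inverse_process_pair] elim
            by simp
          show ?thesis by measurable
        qed
      qed auto
      then show ?case
        using l elim s' by (simp add: emeasure_exponential_distribution_greaterThan S_nonneg)
    qed
  qed
  also have "\<dots> = ennreal (exp (- (s' * ?\<phi>)))"
    using l s' by (subst nn_integral_eq_integral) (auto intro!: integrable_exp_S simp: laplace_transform_S)
  also have "\<dots> = emeasure ?E {s'<..}"
    using \<phi> s' by (simp add: emeasure_exponential_distribution_greaterThan mult.commute)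
  also have "\<dots> = emeasure ?E {s<..}"
    by (rule emeasure_eq_AE) (use AE_exponential_distribution_pos[OF \<phi>] in \<open>auto simp: s'_def elim!: eventually_mono\<close>)
  finally show "emeasure (distr ?P borel ?L) {s<..} = emeasure ?E {s<..}" .
qed auto

end

section \<open>The call price at an exponential operational time\<close>

text \<open>
  The payoff plus the time value of a call whose operational time to maturity is exponential,
  of the rate \<open>\<sigma>\<^sup>2 / 2 b (b - 1)\<close>.
\<close>

definition resolvent_call :: "real \<Rightarrow> real \<Rightarrow> real \<Rightarrow> real" where
  "resolvent_call b K x = call_payoff K x +
     K / (2 * b - 1) * (if x < K then (x / K) powr b else (x / K) powr (1 - b))"

text \<open>
  Below the strike the payoff is non-zero only where the density is a single exponential. Above
  the strike the call is \<open>x exp z - K\<close> plus a put, and it is the put that lives on a single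
  branch; the first part contributes \<open>x - K\<close>, since \<open>exp z\<close> has mean 1.
\<close>

lemma has_bochner_integral_resolvent_call:
  assumes b: "1 < b" and K: "0 < K" and x: "0 < x"
  shows "has_bochner_integral lborel
           (\<lambda>z. asym_laplace_density b z * call_payoff K (x * exp z)) (resolvent_call b K x)"
proof -
  \<comment> \<open>The call is in the money exactly for log-returns above \<open>k\<close>.\<close>
  define k where "k = ln (K / x)"
  define C where "C = b * (b - 1) / (2 * b - 1)"
  have k: "K \<le> x * exp z \<longleftrightarrow> k \<le> z" for z
  proof -
    have "k \<le> z \<longleftrightarrow> K / x \<le> exp z"
      unfolding k_def using K x by (subst ln_le_cancel_iff[symmetric]) (auto simp: ln_ge_iff)
    then show ?thesis using x by (simp add: field_simps)
  qed
  have ek: "exp (a * k) = (x / K) powr (- a)" for a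
    using K x by (simp add: k_def powr_def ln_div algebra_simps)
  have shift: "K * (x / K) powr (1 + a) = x * (x / K) powr a" for a
    using K x by (simp add: powr_add)
  have density: "asym_laplace_density b z = C * (if 0 \<le> z then exp (- (b * z)) else exp ((b - 1) * z))" for z
    by (simp add: asym_laplace_density_def C_def)
  note lo = has_bochner_integral_exp_atMost and hi = has_bochner_integral_exp_atLeast
  show ?thesis
  proof (cases "x < K")
    case True
    then have "0 < k" using x by (simp add: k_def)
    have "has_bochner_integral lborel
        (\<lambda>z. C * x * (indicator {k..} z * exp (- ((b - 1) * z))) - C * K * (indicator {k..} z * exp (- (b * z))))
        (C * x * (exp (- ((b - 1) * k)) / (b - 1)) - C * K * (exp (- (b * k)) / b))"
      using b by (intro has_bochner_integral_diff has_bochner_integral_mult_right hi) auto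
    also have "(\<lambda>z. C * x * (indicator {k..} z * exp (- ((b - 1) * z))) - C * K * (indicator {k..} z * exp (- (b * z)))) =
        (\<lambda>z. asym_laplace_density b z * call_payoff K (x * exp z))"
    proof
      fix z
      have "exp (- ((b - 1) * z)) = exp (- (b * z)) * exp z"
        by (simp add: exp_add[symmetric] algebra_simps)
      then show "C * x * (indicator {k..} z * exp (- ((b - 1) * z))) - C * K * (indicator {k..} z * exp (- (b * z))) =
          asym_laplace_density b z * call_payoff K (x * exp z)"
        using k[of z] \<open>0 < k\<close>
        by (auto simp: indicator_def density call_payoff_def algebra_simps)
    qed
    also have "C * x * (exp (- ((b - 1) * k)) / (b - 1)) - C * K * (exp (- (b * k)) / b) = resolvent_call b K x"
    proof -
      have 1: "exp (- ((b - 1) * k)) = (x / K) powr (b - 1)" "exp (- (b * k)) = (x / K) powr b"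
        using ek[of "- (b - 1)"] ek[of "- b"] by (simp_all only: mult_minus_left minus_minus)
      have 2: "x * (x / K) powr (b - 1) = K * (x / K) powr b" using shift[of "b - 1"] by simp
      have "C * x * (exp (- ((b - 1) * k)) / (b - 1)) - C * K * (exp (- (b * k)) / b)
          = C / (b - 1) * (x * (x / K) powr (b - 1)) - C / b * (K * (x / K) powr b)"
        unfolding 1 by simp
      also have "\<dots> = (C / (b - 1) - C / b) * (K * (x / K) powr b)"
        unfolding 2 by (simp add: algebra_simps)
      also have "C / (b - 1) - C / b = 1 / (2 * b - 1)"
        using b by (simp add: C_def divide_simps; simp add: algebra_simps)
      finally show ?thesis using True by (simp add: resolvent_call_def call_payoff_def)
    qed
    finally show ?thesis .
  next
    case False
    then have "k \<le> 0" using x K by (simp add: k_def ln_div)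
    let ?f = "\<lambda>z. (C * x * (indicator {0..} z * exp (- ((b - 1) * z))) + C * x * (indicator {..0} z * exp (b * z)))
        - (C * K * (indicator {0..} z * exp (- (b * z))) + C * K * (indicator {..0} z * exp ((b - 1) * z)))
        + (C * K * (indicator {..k} z * exp ((b - 1) * z)) - C * x * (indicator {..k} z * exp (b * z)))"
    let ?I = "(C * x * (exp (- ((b - 1) * 0)) / (b - 1)) + C * x * (exp (b * 0) / b))
        - (C * K * (exp (- (b * 0)) / b) + C * K * (exp ((b - 1) * 0) / (b - 1)))
        + (C * K * (exp ((b - 1) * k) / (b - 1)) - C * x * (exp (b * k) / b))"
    have "has_bochner_integral lborel ?f ?I"
      using b by (intro has_bochner_integral_diff has_bochner_integral_add has_bochner_integral_mult_right hi lo) auto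
    also have "?this \<longleftrightarrow> has_bochner_integral lborel
        (\<lambda>z. asym_laplace_density b z * call_payoff K (x * exp z)) ?I"
    proof (rule has_bochner_integral_cong_AE)
      show "AE z in lborel. ?f z = asym_laplace_density b z * call_payoff K (x * exp z)"
        using AE_lborel_singleton[of 0] AE_lborel_singleton[of k]
      proof eventually_elim
        case (elim z)
        have "exp (- ((b - 1) * z)) = exp (- (b * z)) * exp z" "exp (b * z) = exp ((b - 1) * z) * exp z"
          by (simp_all add: exp_add[symmetric] algebra_simps)
        then show ?case
          using k[of z] elim \<open>k \<le> 0\<close>
          by (auto simp: indicator_def density call_payoff_def algebra_simps)
      qed
    qed (auto simp: call_payoff_def)
    also have "?I = resolvent_call b K x"
    proof -
      have 1: "exp ((b - 1) * k) = (x / K) powr (1 - b)" "exp (b * k) = (x / K) powr (- b)"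
        using ek[of "b - 1"] ek[of "b"] by simp_all
      have 2: "x * (x / K) powr (- b) = K * (x / K) powr (1 - b)" using shift[of "- b"] by simp
      have "?I = (C / (b - 1) + C / b) * (x - K) + C / (b - 1) * (K * (x / K) powr (1 - b))
                - C / b * (x * (x / K) powr (- b))"
        unfolding 1 by (simp add: algebra_simps diff_divide_distrib)
      also have "\<dots> = (C / (b - 1) + C / b) * (x - K) + (C / (b - 1) - C / b) * (K * (x / K) powr (1 - b))"
        unfolding 2 by (simp add: algebra_simps)
      also have "C / (b - 1) - C / b = 1 / (2 * b - 1)"
        using b by (simp add: C_def divide_simps; simp add: algebra_simps)
      also have "C / (b - 1) + C / b = 1"
        using b by (simp add: C_def divide_simps; simp add: algebra_simps)
      finally show ?thesis using False by (simp add: resolvent_call_def call_payoff_def)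
    qed
    finally show ?thesis .
  qed
qed

text \<open>
  Interest is absent; \<open>y\<close> is the operational time to maturity, so \<open>\<sigma>\<^sup>2 y\<close> is the variance of the
  log-price.
\<close>

definition black_scholes :: "real \<Rightarrow> real \<Rightarrow> real \<Rightarrow> real \<Rightarrow> real" where
  "black_scholes K \<sigma> x y = (LINT z|std_normal_distribution.
     call_payoff K (x * exp (- (\<sigma>\<^sup>2 * y / 2) + \<sigma> * sqrt y * z)))"

lemma borel_measurable_call_payoff [measurable]: "call_payoff K \<in> borel_measurable borel"
  unfolding call_payoff_def by measurable

lemma borel_measurable_black_scholes [measurable]: "black_scholes K \<sigma> x \<in> borel_measurable borel"
proof -
  interpret N: prob_space std_normal_distribution by (simp add: prob_space_normal_density)
  show ?thesis unfolding black_scholes_def by measurable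
qed

lemma black_scholes_0: "black_scholes K \<sigma> x 0 = call_payoff K x"
proof -
  interpret N: prob_space std_normal_distribution by (simp add: prob_space_normal_density)
  show ?thesis by (simp add: black_scholes_def N.prob_space[simplified])
qed

text \<open>
  The normal mixture is known in law, so the double integral over \<open>y\<close> and \<open>z\<close> is the single integral
  of \<open>has_bochner_integral_resolvent_call\<close>. The indicator repeats the restriction to
  \<open>y \<ge> 0\<close> in the value of the call.
\<close>

lemma black_scholes_exponential_maturity:
  assumes b: "1 < b" and \<sigma>: "0 < \<sigma>" and K: "0 < K" and x: "0 < x"
  defines "\<phi> \<equiv> \<sigma>\<^sup>2 / 2 * (b * (b - 1))"
  shows "has_bochner_integral (exponential_distribution \<phi>) (\<lambda>y. indicator {0..} y * black_scholes K \<sigma> x y) (resolvent_call b K x)"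
proof -
  have \<phi>: "0 < \<phi>" using b \<sigma> by (simp add: \<phi>_def)
  interpret E: prob_space "exponential_distribution \<phi>"
    by (rule prob_space_exponential_density[OF \<phi>])
  interpret N: prob_space std_normal_distribution
    by (simp add: prob_space_normal_density)
  interpret Q: pair_prob_space "exponential_distribution \<phi>" std_normal_distribution ..
  let ?Q = "exponential_distribution \<phi> \<Otimes>\<^sub>M std_normal_distribution"
  let ?Y = "\<lambda>(y, z). - (\<sigma>\<^sup>2 * y / 2) + \<sigma> * sqrt y * z"
  let ?D = "density lborel (asym_laplace_density b)"
  let ?f = "\<lambda>w. call_payoff K (x * exp w)"
  have [measurable]: "?Y \<in> borel_measurable ?Q" by measurable
  have D: "has_bochner_integral ?D ?f (resolvent_call b K x)"
    using has_bochner_integral_resolvent_call[OF b K x] b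
    by (intro has_bochner_integral_density) (auto simp: asym_laplace_density_nonneg)
  have "has_bochner_integral ?Q (\<lambda>q. ?f (?Y q)) (resolvent_call b K x)"
    using D unfolding normal_mixture_asym_laplace[OF b \<sigma>, folded \<phi>_def, symmetric]
    by (simp add: has_bochner_integral_iff integrable_distr_eq integral_distr)
  then have i: "integrable ?Q (\<lambda>q. ?f (?Y q))" "(LINT q|?Q. ?f (?Y q)) = resolvent_call b K x"
    by (auto simp: has_bochner_integral_iff)
  have "has_bochner_integral (exponential_distribution \<phi>) (black_scholes K \<sigma> x) (resolvent_call b K x)"
    using Q.integrable_fst'[OF i(1)] Q.integral_fst'[OF i(1)] i(2)
    by (simp add: has_bochner_integral_iff black_scholes_def[abs_def])
  also have "?this \<longleftrightarrow> ?thesis"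
  proof (rule has_bochner_integral_cong_AE)
    show "AE y in exponential_distribution \<phi>. black_scholes K \<sigma> x y = indicator {0..} y * black_scholes K \<sigma> x y"
      using AE_exponential_distribution_pos[OF \<phi>] by eventually_elim simp
  qed measurable
  finally show ?thesis .
qed

section \<open>The resolvent equation: existence of a weak solution\<close>

text \<open>
  Enlarging the interval makes both functions vanish at its end points too, so that integrations
  by parts leave no boundary terms.
\<close>

lemma test_function_support:
  assumes "test_function \<rho> \<rho>'"
  obtains p q where "0 < p" "p < q" "\<And>x. x \<notin> {p<..<q} \<Longrightarrow> \<rho> x = 0 \<and> \<rho>' x = 0"
proof -
  from assms obtain p q where pq: "0 < p" "\<And>x. x \<notin> {p..q} \<Longrightarrow> \<rho> x = 0"
    and d: "\<And>x. (\<rho> has_real_derivative \<rho>' x) (at x)"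
    by (auto simp: test_function_def)
  have "\<rho>' x = 0" if "x \<notin> {p..q}" for x
  proof -
    have "\<forall>\<^sub>F y in nhds x. y \<in> - {p..q}"
      using that by (intro eventually_nhds_in_open) auto
    then have "\<forall>\<^sub>F y in nhds x. \<rho> y = (\<lambda>_. 0) y"
      by eventually_elim (use pq in auto)
    with d[of x] have "((\<lambda>_. 0) has_real_derivative \<rho>' x) (at x)"
      by (subst (asm) DERIV_cong_ev[OF refl _ refl]) auto
    then show ?thesis by (rule DERIV_unique[OF _ DERIV_const])
  qed
  moreover have "x \<notin> {p..q}" if "x \<notin> {p / 2<..<max p q + 1}" for x
    using that pq(1) by auto
  ultimately show thesis
    using pq by (intro that[of "p / 2" "max p q + 1"]) auto
qed

text \<open>
  Away from \<open>E\<close> the integrand of the weak formulation is the derivative of \<open>- \<sigma>\<^sup>2 / 2 g x\<^sup>2 \<rho>\<close>. This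
  function is continuous across \<open>E\<close>, so the fundamental theorem of calculus applies nevertheless.
\<close>

lemma weak_solutionI_piecewise_classical:
  assumes E: "finite E"
    and cont: "continuous_on {0<..} v" "continuous_on {0<..} g" "continuous_on {0<..} f"
    and v: "\<And>x. 0 < x \<Longrightarrow> x \<notin> E \<Longrightarrow> (v has_real_derivative g x) (at x)"
    and g: "\<And>x. 0 < x \<Longrightarrow> x \<notin> E \<Longrightarrow> (g has_real_derivative h x) (at x)"
    and ode: "\<And>x. 0 < x \<Longrightarrow> x \<notin> E \<Longrightarrow> \<sigma>\<^sup>2 / 2 * x\<^sup>2 * h x - c * v x + f x = 0"
  shows "weak_solution \<sigma> c f v"
  unfolding weak_solution_def
proof (intro exI[of _ g] conjI allI impI)
  show "set_borel_measurable lborel {0<..} g"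
    using borel_measurable_continuous_on_indicator[OF _ cont(2)] by (simp add: set_borel_measurable_def)
next
  fix p q :: real assume pq: "0 < p \<and> p \<le> q"
  then have sub: "{p..q} \<subseteq> {0<..}" by auto
  show "set_integrable lborel {p..q} (\<lambda>x. (g x)\<^sup>2)"
    by (intro borel_integrable_atLeastAtMost' continuous_intros continuous_on_subset[OF cont(2) sub])
  have "(g has_integral (v q - v p)) {p..q}"
    using pq v by (intro fundamental_theorem_of_calculus_strong[OF E] continuous_on_subset[OF cont(1) sub])
      (auto simp: has_real_derivative_iff_has_vector_derivative)
  moreover have "set_integrable lborel {p..q} g"
    by (intro borel_integrable_atLeastAtMost' continuous_on_subset[OF cont(2) sub])
  ultimately show "v q - v p = (LINT x:{p..q}|lborel. g x)"
    by (simp add: set_borel_integral_eq_integral(2) integral_unique)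
next
  fix \<rho> \<rho>' assume t: "test_function \<rho> \<rho>'"
  then obtain p q where pq: "0 < p" "p < q" and 0: "\<And>x. x \<notin> {p<..<q} \<Longrightarrow> \<rho> x = 0 \<and> \<rho>' x = 0"
    by (rule test_function_support) blast
  have \<rho>: "(\<rho> has_real_derivative \<rho>' x) (at x)" for x using t by (simp add: test_function_def)
  have c\<rho>: "continuous_on X \<rho>" "continuous_on X \<rho>'" for X
    using t DERIV_continuous_on[of X \<rho> \<rho>']
    by (auto simp: test_function_def intro: continuous_on_subset has_field_derivative_at_within)
  from pq have sub: "{p..q} \<subseteq> {0<..}" by auto
  note cs = continuous_on_subset[OF cont(1) sub] continuous_on_subset[OF cont(2) sub]
    continuous_on_subset[OF cont(3) sub]
  let ?F = "\<lambda>x. - (\<sigma>\<^sup>2 / 2) * g x * (2 * x * \<rho> x + x\<^sup>2 * \<rho>' x) - c * v x * \<rho> x + f x * \<rho> x"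
  let ?Q = "\<lambda>x. - (\<sigma>\<^sup>2 / 2) * g x * (x\<^sup>2 * \<rho> x)"
  have "(LINT x:{0<..}|lborel. ?F x) = (LINT x:{p..q}|lborel. ?F x)"
    unfolding set_lebesgue_integral_def
  proof (rule Bochner_Integration.integral_cong[OF refl])
    fix x
    show "indicat_real {0<..} x *\<^sub>R ?F x = indicat_real {p..q} x *\<^sub>R ?F x"
      using 0[of x] pq by (auto simp: indicator_def)
  qed
  also have "\<dots> = integral {p..q} ?F"
    by (intro set_borel_integral_eq_integral borel_integrable_atLeastAtMost' continuous_intros cs c\<rho>)
  also have "(?F has_integral (?Q q - ?Q p)) {p..q}"
  proof (rule fundamental_theorem_of_calculus_strong[OF E])
    fix x assume x: "x \<in> {p..q} - E"
    then have x0: "0 < x" "x \<notin> E" using pq by auto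
    have "(?Q has_real_derivative
        - (\<sigma>\<^sup>2 / 2) * h x * (x\<^sup>2 * \<rho> x) + - (\<sigma>\<^sup>2 / 2) * g x * (2 * x * \<rho> x + x\<^sup>2 * \<rho>' x)) (at x)"
      by (auto intro!: derivative_eq_intros g[OF x0] \<rho> simp: algebra_simps)
    moreover have "- (\<sigma>\<^sup>2 / 2) * h x * (x\<^sup>2 * \<rho> x) = - c * v x * \<rho> x + f x * \<rho> x"
    proof -
      have "- (\<sigma>\<^sup>2 / 2) * h x * (x\<^sup>2 * \<rho> x) = (- (\<sigma>\<^sup>2 / 2 * x\<^sup>2 * h x)) * \<rho> x" by simp
      also have "- (\<sigma>\<^sup>2 / 2 * x\<^sup>2 * h x) = - c * v x + f x" using ode[OF x0] by simp
      finally show ?thesis by (simp add: algebra_simps)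
    qed
    ultimately show "(?Q has_vector_derivative ?F x) (at x)"
      unfolding has_real_derivative_iff_has_vector_derivative[symmetric] by (simp add: algebra_simps)
  qed (use pq in \<open>auto intro!: continuous_intros cs c\<rho>\<close>)
  then have "integral {p..q} ?F = 0"
    using 0[of p] 0[of q] by (simp add: integral_unique)
  finally show "(LINT x:{0<..}|lborel. ?F x) = 0" .
qed

text \<open>
  Only the strike is exceptional. The coefficient \<open>K / (2 b - 1)\<close> of the time value is the one
  for which the first derivative is continuous there.
\<close>

lemma weak_solution_resolvent_call:
  fixes \<sigma> :: real
  assumes b: "1 < b" and K: "0 < K" and l: "0 < l"
  defines "\<phi> \<equiv> \<sigma>\<^sup>2 / 2 * (b * (b - 1))"
  shows "weak_solution \<sigma> \<phi> (\<lambda>x. \<phi> / l * call_payoff K x) (\<lambda>x. resolvent_call b K x / l)"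
proof -
  let ?g = "\<lambda>x. (if x < K then b / (2 * b - 1) * (x / K) powr (b - 1)
                  else 1 + (1 - b) / (2 * b - 1) * (x / K) powr (- b)) / l"
  let ?h = "\<lambda>x. b * (b - 1) / ((2 * b - 1) * l * K) *
                  (if x < K then (x / K) powr (b - 2) else (x / K) powr (- b - 1))"
  have glue: "continuous_on {0<..} (\<lambda>x. if x < K then p x else q x)"
    if "continuous_on {0<..} p" "continuous_on {0<..} q" "p K = q K" for p q :: "real \<Rightarrow> real"
  proof -
    have "continuous_on {0<..} (\<lambda>x. if x \<le> K then p x else q x)"
      using that by (intro continuous_on_cases_le continuous_on_id)
        (auto intro: continuous_on_subset)
    also have "(\<lambda>x. if x \<le> K then p x else q x) = (\<lambda>x. if x < K then p x else q x)"
      using that(3) by auto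
    finally show ?thesis .
  qed
  show ?thesis
  proof (rule weak_solutionI_piecewise_classical[where E = "{K}" and g = ?g and h = ?h])
    show "finite {K}" by simp
    show "continuous_on {0<..} (\<lambda>x. \<phi> / l * call_payoff K x)"
      unfolding call_payoff_def by (intro continuous_intros)
    show "continuous_on {0<..} (\<lambda>x. resolvent_call b K x / l)"
      unfolding resolvent_call_def call_payoff_def divide_inverse using K
      by (intro continuous_intros glue) auto
    show "continuous_on {0<..} ?g"
      unfolding divide_inverse using K b
      by (intro continuous_on_mult continuous_on_const glue continuous_intros) (auto simp: divide_simps)
    fix x :: real assume x: "0 < x" "x \<notin> {K}"
    have pw: "((\<lambda>x. (x / K) powr a) has_real_derivative a / K * (x / K) powr (a - 1)) (at x)" for a
      using K x by (auto intro!: derivative_eq_intros)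
    consider "x < K" | "K < x" using x by fastforce
    then have "((\<lambda>x. resolvent_call b K x / l) has_real_derivative ?g x) (at x) \<and>
        (?g has_real_derivative ?h x) (at x)"
    proof cases
      case 1
      have "((\<lambda>x. K / (2 * b - 1) * (x / K) powr b / l) has_real_derivative ?g x) (at x)"
        using 1 K b x l by (auto intro!: derivative_eq_intros pw simp: mult_ac)
      then have "((\<lambda>x. resolvent_call b K x / l) has_real_derivative ?g x) (at x)"
        by (rule has_field_derivative_transform_within_open[where S="{..<K}"])
           (use 1 in \<open>auto simp: resolvent_call_def call_payoff_def\<close>)
      moreover have "((\<lambda>x. b / (2 * b - 1) * (x / K) powr (b - 1) / l) has_real_derivative ?h x) (at x)"
        using 1 K b x l by (auto intro!: derivative_eq_intros pw simp: mult_ac)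
      then have "(?g has_real_derivative ?h x) (at x)"
        by (rule has_field_derivative_transform_within_open[where S="{..<K}"]) (use 1 in auto)
      ultimately show ?thesis ..
    next
      case 2
      have "((\<lambda>x. (x - K + K / (2 * b - 1) * (x / K) powr (1 - b)) / l) has_real_derivative ?g x) (at x)"
        using 2 K b x l by (auto intro!: derivative_eq_intros pw simp: mult_ac)
      then have "((\<lambda>x. resolvent_call b K x / l) has_real_derivative ?g x) (at x)"
        by (rule has_field_derivative_transform_within_open[where S="{K<..}"])
           (use 2 in \<open>auto simp: resolvent_call_def call_payoff_def\<close>)
      moreover have "((\<lambda>x. (1 + (1 - b) / (2 * b - 1) * (x / K) powr (- b)) / l) has_real_derivative ?h x) (at x)"
      proof -
        have "(0 + (1 - b) / (2 * b - 1) * (- b / K * P)) / l = b * (b - 1) / ((2 * b - 1) * l * K) * P" for P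
          using K b l by (simp add: divide_simps) (simp add: algebra_simps)
        note coeff = this
        have "((\<lambda>x. (1 + (1 - b) / (2 * b - 1) * (x / K) powr (- b)) / l) has_real_derivative
            (0 + (1 - b) / (2 * b - 1) * (- b / K * (x / K) powr (- b - 1))) / l) (at x)"
          by (intro DERIV_cdivide DERIV_add DERIV_const DERIV_cmult pw)
        then show ?thesis unfolding coeff using 2 by simp
      qed
      then have "(?g has_real_derivative ?h x) (at x)"
        by (rule has_field_derivative_transform_within_open[where S="{K<..}"]) (use 2 in auto)
      ultimately show ?thesis ..
    qed
    then show "((\<lambda>x. resolvent_call b K x / l) has_real_derivative ?g x) (at x)"
      and "(?g has_real_derivative ?h x) (at x)" by auto
    show "\<sigma>\<^sup>2 / 2 * x\<^sup>2 * ?h x - \<phi> * (resolvent_call b K x / l) + \<phi> / l * call_payoff K x = 0"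
    proof -
      have pw2: "x\<^sup>2 * (x / K) powr (a - 2) = K\<^sup>2 * (x / K) powr a" for a
      proof -
        have "(x / K) powr a = (x / K) powr (a - 2) * (x / K) powr 2"
          by (simp only: powr_add[symmetric]) simp
        also have "(x / K) powr 2 = (x / K)\<^sup>2"
          by (rule powr_numeral) (use x K in simp)
        also have "K\<^sup>2 * ((x / K) powr (a - 2) * (x / K)\<^sup>2) = (K\<^sup>2 * (x / K)\<^sup>2) * (x / K) powr (a - 2)"
          by (simp only: mult_ac)
        also have "K\<^sup>2 * (x / K)\<^sup>2 = x\<^sup>2"
          using K by (simp add: power_divide)
        finally show ?thesis ..
      qed
      have "- b - 1 = 1 - b - 2" by simp
      with pw2[of b] pw2[of "1 - b"]
      have "x\<^sup>2 * (if x < K then (x / K) powr (b - 2) else (x / K) powr (- b - 1)) =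
          K\<^sup>2 * (if x < K then (x / K) powr b else (x / K) powr (1 - b))" (is "_ * ?P = _ * ?R")
        by (cases "x < K") (simp_all only: if_True if_False)
      note R = this
      have "\<sigma>\<^sup>2 / 2 * x\<^sup>2 * ?h x = \<sigma>\<^sup>2 / 2 * (b * (b - 1) / ((2 * b - 1) * l * K)) * (x\<^sup>2 * ?P)"
        by (simp only: mult_ac)
      also have "\<dots> = \<sigma>\<^sup>2 / 2 * (b * (b - 1) / ((2 * b - 1) * l * K)) * (K\<^sup>2 * ?R)"
        by (simp only: R)
      also have "\<dots> = \<phi> * (K / (2 * b - 1) * ?R) / l"
      proof -
        have "\<sigma>\<^sup>2 / 2 * (B / (d * l * K)) * (K\<^sup>2 * R) = \<sigma>\<^sup>2 / 2 * B * (K / d * R) / l" for B d R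
          using K by (simp add: power2_eq_square mult_ac)
        then show ?thesis unfolding \<phi>_def .
      qed
      finally show ?thesis
        by (simp add: resolvent_call_def diff_divide_distrib add_divide_distrib algebra_simps)
    qed
  qed
qed

text \<open>
  The time value is at most \<open>K\<close>, because both powers are at most 1 on their side of the strike.
\<close>

lemma linear_growth_resolvent_call:
  assumes b: "1 < b" and K: "0 < K" and l: "0 < l"
  shows "linear_growth (\<lambda>x. resolvent_call b K x / l)"
  unfolding linear_growth_def
proof (intro exI[of _ "(1 + K) / l"] allI impI)
  fix x :: real assume x: "0 < x"
  let ?R = "if x < K then (x / K) powr b else (x / K) powr (1 - b)"
  have "?R \<le> 1"
  proof (cases "x < K")
    case True
    then show ?thesis using x b by (simp add: powr_le1)
  next
    case False
    then have "(x / K) powr (1 - b) \<le> 1 powr (1 - b)"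
      using b K by (intro powr_mono2') auto
    then show ?thesis using False by simp
  qed
  moreover have "0 \<le> ?R" by simp
  moreover have "0 \<le> K / (2 * b - 1)" "K / (2 * b - 1) \<le> K"
    using b K by (auto simp: divide_simps)
  ultimately have "0 \<le> K / (2 * b - 1) * ?R" "K / (2 * b - 1) * ?R \<le> K * 1"
    using K by (blast intro: mult_nonneg_nonneg, intro mult_mono) auto
  moreover have "0 \<le> call_payoff K x" "call_payoff K x \<le> x"
    using x K by (auto simp: call_payoff_def)
  ultimately have "\<bar>resolvent_call b K x\<bar> \<le> x + K"
    unfolding resolvent_call_def by linarith
  also have "\<dots> \<le> (1 + K) * (1 + x)"
    using x K by (simp add: algebra_simps)
  finally have "\<bar>resolvent_call b K x\<bar> \<le> (1 + K) * (1 + x)" .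
  then show "\<bar>resolvent_call b K x / l\<bar> \<le> (1 + K) / l * (1 + x)"
    using l by (simp add: divide_right_mono)
qed

section \<open>The resolvent equation: weak solutions of the homogeneous equation are classical\<close>

text \<open>
  A continuously differentiable primitive of the positive part, from which explicit test
  functions are built.
\<close>

definition half_square :: "real \<Rightarrow> real" where "half_square x = (max 0 x)\<^sup>2 / 2"

lemma DERIV_half_square: "(half_square has_real_derivative max 0 x) (at x)"
proof (cases "x = 0")
  case True
  have "(\<lambda>h. (half_square (0 + h) - half_square 0) / h) \<midarrow>0\<rightarrow> 0"
  proof (rule tendsto_0_le[where K = 1])
    show "((\<lambda>h::real. h) \<longlongrightarrow> 0) (at 0)" by (rule tendsto_ident_at)
    have "\<bar>half_square h / h\<bar> \<le> \<bar>h\<bar>" for h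
      by (auto simp: half_square_def max_def power2_eq_square)
    then show "\<forall>\<^sub>F h in at 0. norm ((half_square (0 + h) - half_square 0) / h) \<le> norm h * 1"
      by (simp add: half_square_def)
  qed
  then show ?thesis using True by (simp add: DERIV_def)
next
  case False
  then consider "0 < x" | "x < 0" by linarith
  then show ?thesis
  proof cases
    case 1
    have "((\<lambda>x. x\<^sup>2 / 2) has_real_derivative max 0 x) (at x)"
      using 1 by (auto intro!: derivative_eq_intros)
    then show ?thesis
      by (rule has_field_derivative_transform_within_open[where S = "{0<..}"])
        (use 1 in \<open>auto simp: half_square_def\<close>)
  next
    case 2
    have "((\<lambda>x. 0) has_real_derivative max 0 x) (at x)"
      using 2 by (auto intro!: derivative_eq_intros)
    then show ?thesis
      by (rule has_field_derivative_transform_within_open[where S = "{..<0}"])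
        (use 2 in \<open>auto simp: half_square_def\<close>)
  qed
qed

text \<open>
  A continuous approximation of the indicator of \<open>[p, q]\<close>: it rises from 0 to 1 on \<open>[p, p + e]\<close> and
  falls back to 0 on \<open>[q - e, q]\<close>. Its support lies in \<open>[p, q]\<close>, hence in the domain of the equation.
\<close>

definition trapezoid :: "real \<Rightarrow> real \<Rightarrow> real \<Rightarrow> real \<Rightarrow> real" where
  "trapezoid p q e x = (max 0 (x - p) - max 0 (x - p - e) - max 0 (x - q + e) + max 0 (x - q)) / e"

definition trapezoid_primitive :: "real \<Rightarrow> real \<Rightarrow> real \<Rightarrow> real \<Rightarrow> real" where
  "trapezoid_primitive p q e x =
     (half_square (x - p) - half_square (x - p - e) - half_square (x - q + e) + half_square (x - q)) / e"

lemma DERIV_trapezoid_primitive: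
  "(trapezoid_primitive p q e has_real_derivative trapezoid p q e x) (at x)"
proof -
  have s: "((\<lambda>x. half_square (x - a)) has_real_derivative max 0 (x - a)) (at x)" for a
    using DERIV_chain2[where f = half_square and g = "\<lambda>x. x - a" and x = x and s = UNIV
        and Da = "max 0 (x - a)" and Db = 1, OF DERIV_half_square]
    by (simp add: DERIV_diff[OF DERIV_ident DERIV_const, simplified])
  from DERIV_cdivide[OF DERIV_add[OF DERIV_diff[OF DERIV_diff[OF s[of p] s[of "p + e"]] s[of "q - e"]] s[of q]], of e]
  show ?thesis
    unfolding trapezoid_primitive_def trapezoid_def by (simp add: algebra_simps)
qed

lemma trapezoid_primitive_left: "0 < e \<Longrightarrow> 2 * e < q - p \<Longrightarrow> x \<le> p \<Longrightarrow> trapezoid_primitive p q e x = 0"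
  by (simp add: trapezoid_primitive_def half_square_def)

lemma trapezoid_primitive_right:
  "0 < e \<Longrightarrow> 2 * e < q - p \<Longrightarrow> q \<le> x \<Longrightarrow> trapezoid_primitive p q e x = q - p - e"
  by (simp add: trapezoid_primitive_def half_square_def field_simps power2_eq_square)

lemma trapezoid_outside: "0 < e \<Longrightarrow> 2 * e < q - p \<Longrightarrow> x \<le> p \<or> q \<le> x \<Longrightarrow> trapezoid p q e x = 0"
  by (auto simp: trapezoid_def)

lemma trapezoid_plateau:
  "0 < e \<Longrightarrow> p + e \<le> x \<Longrightarrow> x \<le> q - e \<Longrightarrow> trapezoid p q e x = 1"
  by (auto simp: trapezoid_def)

lemma abs_trapezoid_le: "0 < e \<Longrightarrow> \<bar>trapezoid p q e x\<bar> \<le> 1"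
  unfolding trapezoid_def by (simp add: abs_le_iff field_simps) linarith

lemma continuous_on_trapezoid: "0 < e \<Longrightarrow> continuous_on A (trapezoid p q e)"
  unfolding trapezoid_def by (intro continuous_intros) auto

lemma tendsto_integral_trapezoid:
  assumes h: "set_integrable lborel {p..q} h" and pq: "p < q"
  shows "(\<lambda>n. LINT x:{p..q}|lborel. h x * trapezoid p q ((q - p) / real (n + 3)) x) \<longlonglongrightarrow>
           (LINT x:{p..q}|lborel. h x)"
  unfolding set_lebesgue_integral_def
proof (rule integral_dominated_convergence[where w = "\<lambda>x. \<bar>indicator {p..q} x *\<^sub>R h x\<bar>"])
  let ?e = "\<lambda>n. (q - p) / real (n + 3)"
  have e: "0 < ?e n" for n using pq by simp
  have h': "integrable lborel (\<lambda>x. indicator {p..q} x *\<^sub>R h x)"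
    using h by (simp add: set_integrable_def)
  then show "integrable lborel (\<lambda>x. \<bar>indicator {p..q} x *\<^sub>R h x\<bar>)" by (rule integrable_abs)
  from h' show m: "(\<lambda>x. indicator {p..q} x *\<^sub>R h x) \<in> borel_measurable lborel" by simp
  have [measurable]: "trapezoid p q (?e n) \<in> borel_measurable borel" for n
    unfolding trapezoid_def by measurable
  have "(\<lambda>x. (indicator {p..q} x *\<^sub>R h x) * trapezoid p q (?e n) x) \<in> borel_measurable lborel" for n
    using m by measurable
  then show "(\<lambda>x. indicator {p..q} x *\<^sub>R (h x * trapezoid p q (?e n) x)) \<in> borel_measurable lborel" for n
    by (simp add: mult.assoc)
  show "AE x in lborel. norm (indicator {p..q} x *\<^sub>R (h x * trapezoid p q (?e n) x)) \<le> \<bar>indicator {p..q} x *\<^sub>R h x\<bar>" for n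
    using abs_trapezoid_le[OF e[of n]] by (auto simp: abs_mult indicator_def intro!: mult_left_le)
  show "AE x in lborel. (\<lambda>n. indicator {p..q} x *\<^sub>R (h x * trapezoid p q (?e n) x)) \<longlonglongrightarrow> indicator {p..q} x *\<^sub>R h x"
    using AE_lborel_singleton[of p] AE_lborel_singleton[of q]
  proof eventually_elim
    case (elim x)
    show ?case
    proof (cases "x \<in> {p<..<q}")
      case True
      have "?e \<longlonglongrightarrow> 0"
        by (rule LIMSEQ_ignore_initial_segment[OF lim_const_over_n])
      then have "\<forall>\<^sub>F n in sequentially. ?e n < min (x - p) (q - x)"
        using True by (intro order_tendstoD) auto
      then have "\<forall>\<^sub>F n in sequentially. indicator {p..q} x *\<^sub>R (h x * trapezoid p q (?e n) x) = indicator {p..q} x *\<^sub>R h x"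
        by eventually_elim (use e in \<open>simp add: trapezoid_plateau\<close>)
      then show ?thesis by (rule tendsto_eventually)
    next
      case False
      then show ?thesis using elim by (auto simp: indicator_def)
    qed
  qed
qed

text \<open>
  The derivatives of the test functions are the continuous functions of integral 0 with compact
  support in \<open>(0, \<infinity>)\<close>, in particular the difference of two trapezoids divided by their integrals. In the limit the
  means of \<open>h\<close> over \<open>[p, q]\<close> and over the reference interval \<open>[1, 2]\<close> agree.
\<close>

lemma du_bois_reymond:
  fixes h :: "real \<Rightarrow> real"
  assumes h: "\<And>p q. 0 < p \<Longrightarrow> p \<le> q \<Longrightarrow> set_integrable lborel {p..q} h"
    and orth: "\<And>\<zeta> \<zeta>'. test_function \<zeta> \<zeta>' \<Longrightarrow> (LINT x:{0<..}|lborel. h x * \<zeta>' x) = 0"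
    and pq: "0 < p" "p \<le> q"
  shows "(LINT x:{p..q}|lborel. h x) = (LINT x:{1..2}|lborel. h x) * (q - p)"
proof (cases "p = q")
  case True
  have "(LINT x:{p..q}|lborel. h x) = 0"
    unfolding set_lebesgue_integral_def
  proof (rule integral_eq_zero_AE)
    show "AE x in lborel. indicator {p..q} x *\<^sub>R h x = 0"
      using AE_lborel_singleton[of q] by eventually_elim (use True in simp)
  qed
  then show ?thesis using True by simp
next
  case False
  with pq have "p < q" by simp
  let ?A = "\<lambda>p q n. (LINT x:{p..q}|lborel. h x * trapezoid p q ((q - p) / real (n + 3)) x) /
      (q - p - (q - p) / real (n + 3))"
  have lim: "?A p q \<longlonglongrightarrow> (LINT x:{p..q}|lborel. h x) / (q - p - 0)" if "0 < p" "p < q" for p q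
    using that
    by (intro tendsto_divide tendsto_integral_trapezoid h tendsto_diff tendsto_const
        LIMSEQ_ignore_initial_segment[OF lim_const_over_n]) auto
  have "?A p q n = ?A 1 2 n" for n
  proof -
    \<comment> \<open>The ramps must satisfy \<open>2 e < q - p\<close> to leave a plateau for every \<open>n\<close>; hence the 3.\<close>
  define e e' where "e = (q - p) / real (n + 3)" and "e' = (2 - 1 :: real) / real (n + 3)"
    have e: "0 < e" "2 * e < q - p" and e': "0 < e'" "2 * e' < 2 - 1"
    proof -
      have "(q - p) * (2 / real (n + 3)) < (q - p) * 1"
        using \<open>p < q\<close> by (intro mult_strict_left_mono) (auto simp: field_simps)
      then show "0 < e" "2 * e < q - p" "0 < e'" "2 * e' < 2 - 1"
        using \<open>p < q\<close> by (simp_all add: e_def e'_def mult.commute)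
    qed
    let ?\<zeta> = "\<lambda>x. trapezoid_primitive p q e x / (q - p - e) - trapezoid_primitive 1 2 e' x / (2 - 1 - e')"
    let ?\<zeta>' = "\<lambda>x. trapezoid p q e x / (q - p - e) - trapezoid 1 2 e' x / (2 - 1 - e')"
    have "test_function ?\<zeta> ?\<zeta>'"
      unfolding test_function_def
    proof (intro conjI allI)
      show "(?\<zeta> has_real_derivative ?\<zeta>' x) (at x)" for x
        by (intro DERIV_diff DERIV_cdivide DERIV_trapezoid_primitive)
      show "continuous_on UNIV ?\<zeta>'"
        using e e' by (intro continuous_intros continuous_on_trapezoid) auto
      have "?\<zeta> x = 0" if "x \<notin> {min p 1..max q 2}" for x
      proof -
        have "x \<le> min p 1 \<or> max q 2 \<le> x" using that by auto
        then show ?thesis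
          using e e' by (auto simp: trapezoid_primitive_left trapezoid_primitive_right)
      qed
      then show "\<exists>p' q'. 0 < p' \<and> (\<forall>x. x \<notin> {p'..q'} \<longrightarrow> ?\<zeta> x = 0)"
        using pq by (intro exI[of _ "min p 1"] exI[of _ "max q 2"]) auto
    qed
    from orth[OF this] have 0: "(LINT x:{0<..}|lborel. h x * ?\<zeta>' x) = 0" .
    have part: "set_integrable lborel {0<..} (\<lambda>x. h x * trapezoid p q e x / (q - p - e))"
      "(LINT x:{0<..}|lborel. h x * trapezoid p q e x / (q - p - e)) =
       (LINT x:{p..q}|lborel. h x * trapezoid p q e x) / (q - p - e)"
      if pq: "0 < p" "p < q" and e: "0 < e" "2 * e < q - p" for p q e
    proof -
      have eq: "indicator {0<..} x *\<^sub>R (h x * trapezoid p q e x / (q - p - e)) =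
          (indicator {p..q} x *\<^sub>R (h x * trapezoid p q e x)) / (q - p - e)" for x
        using pq trapezoid_outside[OF e, of x] by (auto simp: indicator_def)
      have int: "integrable lborel (\<lambda>x. indicator {p..q} x *\<^sub>R (h x * trapezoid p q e x))"
      proof (rule Bochner_Integration.integrable_bound)
        show i: "integrable lborel (\<lambda>x. indicator {p..q} x *\<^sub>R h x)"
          using h[of p q] pq by (simp add: set_integrable_def)
        have [measurable]: "trapezoid p q e \<in> borel_measurable borel"
          unfolding trapezoid_def by measurable
        have "(\<lambda>x. (indicator {p..q} x *\<^sub>R h x) * trapezoid p q e x) \<in> borel_measurable lborel"
          using borel_measurable_integrable[OF i] by measurable
        then show "(\<lambda>x. indicator {p..q} x *\<^sub>R (h x * trapezoid p q e x)) \<in> borel_measurable lborel"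
          by (simp add: mult.assoc)
        show "AE x in lborel. norm (indicator {p..q} x *\<^sub>R (h x * trapezoid p q e x)) \<le> norm (indicator {p..q} x *\<^sub>R h x)"
          using abs_trapezoid_le[OF e(1)] by (auto simp: abs_mult indicator_def intro!: mult_left_le)
      qed
      show "set_integrable lborel {0<..} (\<lambda>x. h x * trapezoid p q e x / (q - p - e))"
        unfolding set_integrable_def eq using int by (rule integrable_divide)
      show "(LINT x:{0<..}|lborel. h x * trapezoid p q e x / (q - p - e)) =
       (LINT x:{p..q}|lborel. h x * trapezoid p q e x) / (q - p - e)"
        unfolding set_lebesgue_integral_def eq by (rule integral_divide_zero)
    qed
    have "(LINT x:{0<..}|lborel. h x * ?\<zeta>' x) =
        (LINT x:{0<..}|lborel. h x * trapezoid p q e x / (q - p - e)) -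
        (LINT x:{0<..}|lborel. h x * trapezoid 1 2 e' x / (2 - 1 - e'))"
      using part(1)[OF pq(1) \<open>p < q\<close> e] part(1)[OF _ _ e']
      by (subst set_integral_diff(2)[symmetric]) (auto simp: right_diff_distrib)
    moreover have "(LINT x:{0<..}|lborel. h x * trapezoid 1 2 e' x / (2 - 1 - e')) =
        (LINT x:{1..2}|lborel. h x * trapezoid 1 2 e' x) / (2 - 1 - e')"
      by (rule part(2)[OF _ _ e']) auto
    ultimately show ?thesis
      using 0 part(2)[OF pq(1) \<open>p < q\<close> e]
      unfolding e_def[symmetric] e'_def[symmetric] by linarith
  qed
  then have "?A p q = ?A 1 2" by (rule ext)
  with lim[of p q] lim[of 1 2] pq \<open>p < q\<close>
  have "(LINT x:{p..q}|lborel. h x) / (q - p - 0) = (LINT x:{1..2}|lborel. h x) / (2 - 1 - 0)"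
    by (intro LIMSEQ_unique[of "?A p q"]) auto
  then show ?thesis using \<open>p < q\<close> by (simp add: divide_simps)
qed

text \<open>
  Local square integrability gives local integrability since \<open>\<bar>y\<bar> \<le> 1 + y\<^sup>2\<close>; the solution is then
  continuous as an indefinite integral.
\<close>

lemma weak_solution_regularity:
  assumes "weak_solution \<sigma> c f v"
  obtains g where "\<And>p q. 0 < p \<Longrightarrow> p \<le> q \<Longrightarrow> set_integrable lborel {p..q} g"
    "\<And>p q. 0 < p \<Longrightarrow> p \<le> q \<Longrightarrow> v q - v p = (LINT x:{p..q}|lborel. g x)"
    "continuous_on {0<..} v"
    "\<And>\<rho> \<rho>'. test_function \<rho> \<rho>' \<Longrightarrow>
       (LINT x:{0<..}|lborel.
          - (\<sigma>\<^sup>2 / 2) * g x * (2 * x * \<rho> x + x\<^sup>2 * \<rho>' x) - c * v x * \<rho> x + f x * \<rho> x) = 0"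
proof -
  from assms obtain g where meas: "set_borel_measurable lborel {0<..} g"
    and sq: "\<And>p q. 0 < p \<Longrightarrow> p \<le> q \<Longrightarrow> set_integrable lborel {p..q} (\<lambda>x. (g x)\<^sup>2)"
    and prim: "\<And>p q. 0 < p \<Longrightarrow> p \<le> q \<Longrightarrow> v q - v p = (LINT x:{p..q}|lborel. g x)"
    and eq: "\<And>\<rho> \<rho>'. test_function \<rho> \<rho>' \<Longrightarrow>
       (LINT x:{0<..}|lborel.
          - (\<sigma>\<^sup>2 / 2) * g x * (2 * x * \<rho> x + x\<^sup>2 * \<rho>' x) - c * v x * \<rho> x + f x * \<rho> x) = 0"
    unfolding weak_solution_def by blast
  have int: "set_integrable lborel {p..q} g" if pq: "0 < p" "p \<le> q" for p q
  proof -
    have "set_integrable lborel {p..q} (\<lambda>x. 1 + (g x)\<^sup>2)"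
      by (intro set_integral_add sq pq borel_integrable_atLeastAtMost' continuous_on_const)
    then show ?thesis
    proof (rule set_integrable_bound)
      show "set_borel_measurable lborel {p..q} g"
        using meas by (rule set_borel_measurable_subset) (use pq in auto)
      have "\<bar>y\<bar> \<le> \<bar>1 + y\<^sup>2\<bar>" for y :: real
      proof -
        have "0 \<le> (\<bar>y\<bar> - 1)\<^sup>2" by simp
        then have "2 * \<bar>y\<bar> \<le> 1 + y\<^sup>2" by (simp add: power2_eq_square algebra_simps)
        then show ?thesis by (smt (verit) abs_ge_zero)
      qed
      then show "AE x in lborel. x \<in> {p..q} \<longrightarrow> norm (g x) \<le> norm (1 + (g x)\<^sup>2)" by simp
    qed
  qed
  have "continuous_on {0<..} v"
  proof (rule continuous_at_imp_continuous_on, rule ballI)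
    fix x :: real assume "x \<in> {0<..}"
    then have x: "0 < x" by simp
    let ?p = "x / 2" and ?q = "x + 1"
    have "continuous_on {?p..?q} (\<lambda>y. integral {?p..y} g)"
      using int[of ?p ?q] x by (intro indefinite_integral_continuous_1 set_borel_integral_eq_integral) auto
    then have "continuous_on {?p..?q} (\<lambda>y. v ?p + integral {?p..y} g)"
      by (intro continuous_intros)
    also have "continuous_on {?p..?q} (\<lambda>y. v ?p + integral {?p..y} g) \<longleftrightarrow> continuous_on {?p..?q} v"
    proof (rule continuous_on_cong[OF refl])
      fix y assume "y \<in> {?p..?q}"
      then show "v ?p + integral {?p..y} g = v y"
        using prim[of ?p y] int[of ?p y] x by (simp add: set_borel_integral_eq_integral(2))
    qed
    finally show "isCont v x"
      using x by (auto intro: continuous_on_interior)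
  qed
  with int prim eq show thesis by (intro that)
qed

text \<open>
  Testing with \<open>\<zeta> / x\<^sup>2\<close> removes the variable coefficient: \<open>x\<^sup>2 \<rho> = \<zeta>\<close>, so only \<open>\<zeta>'\<close> multiplies the weak
  derivative. Continuity of \<open>f\<close> is what makes the two weak formulations integrable, so that they can
  be subtracted.
\<close>

lemma weak_solution_difference:
  assumes v: "weak_solution \<sigma> c f v" and w: "weak_solution \<sigma> c f w" and f: "continuous_on {0<..} f"
  obtains g where "\<And>p q. 0 < p \<Longrightarrow> p \<le> q \<Longrightarrow> set_integrable lborel {p..q} g"
    "\<And>p q. 0 < p \<Longrightarrow> p \<le> q \<Longrightarrow> (v q - w q) - (v p - w p) = (LINT x:{p..q}|lborel. g x)"
    "continuous_on {0<..} (\<lambda>x. v x - w x)"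
    "\<And>\<zeta> \<zeta>'. test_function \<zeta> \<zeta>' \<Longrightarrow>
       (LINT x:{0<..}|lborel. \<sigma>\<^sup>2 / 2 * g x * \<zeta>' x + c * (v x - w x) / x\<^sup>2 * \<zeta> x) = 0"
proof -
  obtain g where g: "\<And>p q. 0 < p \<Longrightarrow> p \<le> q \<Longrightarrow> set_integrable lborel {p..q} g"
    "\<And>p q. 0 < p \<Longrightarrow> p \<le> q \<Longrightarrow> v q - v p = (LINT x:{p..q}|lborel. g x)"
    "continuous_on {0<..} v"
    "\<And>\<rho> \<rho>'. test_function \<rho> \<rho>' \<Longrightarrow>
       (LINT x:{0<..}|lborel.
          - (\<sigma>\<^sup>2 / 2) * g x * (2 * x * \<rho> x + x\<^sup>2 * \<rho>' x) - c * v x * \<rho> x + f x * \<rho> x) = 0"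
    using weak_solution_regularity[OF v] by blast
  obtain k where k: "\<And>p q. 0 < p \<Longrightarrow> p \<le> q \<Longrightarrow> set_integrable lborel {p..q} k"
    "\<And>p q. 0 < p \<Longrightarrow> p \<le> q \<Longrightarrow> w q - w p = (LINT x:{p..q}|lborel. k x)"
    "continuous_on {0<..} w"
    "\<And>\<rho> \<rho>'. test_function \<rho> \<rho>' \<Longrightarrow>
       (LINT x:{0<..}|lborel.
          - (\<sigma>\<^sup>2 / 2) * k x * (2 * x * \<rho> x + x\<^sup>2 * \<rho>' x) - c * w x * \<rho> x + f x * \<rho> x) = 0"
    using weak_solution_regularity[OF w] by blast
  have "(LINT x:{0<..}|lborel. \<sigma>\<^sup>2 / 2 * (g x - k x) * \<zeta>' x + c * (v x - w x) / x\<^sup>2 * \<zeta> x) = 0"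
    if t: "test_function \<zeta> \<zeta>'" for \<zeta> \<zeta>'
  proof -
    obtain p q where pq: "0 < p" "p < q" and 0: "\<And>x. x \<notin> {p<..<q} \<Longrightarrow> \<zeta> x = 0 \<and> \<zeta>' x = 0"
      using test_function_support[OF t] by blast
    have \<zeta>: "(\<zeta> has_real_derivative \<zeta>' x) (at x)" for x using t by (simp add: test_function_def)
    have c\<zeta>': "continuous_on X \<zeta>'" for X
      using t by (auto simp: test_function_def intro: continuous_on_subset)
    have c\<zeta>: "continuous_on X \<zeta>" for X
      by (rule continuous_at_imp_continuous_on) (blast intro: DERIV_isCont \<zeta>)
    let ?\<rho> = "\<lambda>x. \<zeta> x / x\<^sup>2" and ?\<rho>' = "\<lambda>x. \<zeta>' x / x\<^sup>2 - 2 * \<zeta> x / x ^ 3"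
    have d: "(?\<rho> has_real_derivative ?\<rho>' x) (at x)" for x
    proof (cases "x = 0")
      case True
      have "((\<lambda>_. 0) has_real_derivative ?\<rho>' 0) (at 0)" by simp
      then have "(?\<rho> has_real_derivative ?\<rho>' 0) (at 0)"
        by (rule has_field_derivative_transform_within_open[where S = "{..<p}"])
          (use 0 pq in auto)
      then show ?thesis using True by simp
    next
      case False
      then show ?thesis
        by (auto intro!: derivative_eq_intros \<zeta> simp: divide_simps)
           (simp add: algebra_simps power_numeral_reduce)
    qed
    have c: "continuous_on UNIV ?\<rho>'"
    proof -
      have "continuous_on {p/2..} ?\<rho>'"
        using pq by (intro continuous_intros c\<zeta> c\<zeta>') auto
      moreover have "continuous_on {..p} ?\<rho>'"
      proof -
        have "continuous_on {..p} (\<lambda>_. 0 :: real)" by (rule continuous_on_const)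
        then show ?thesis by (rule continuous_on_eq) (use 0 in auto)
      qed
      ultimately have "continuous_on ({p/2..} \<union> {..p}) ?\<rho>'"
        by (intro continuous_on_closed_Un) auto
      also have "{p/2..} \<union> {..p} = UNIV" using pq by auto
      finally show ?thesis .
    qed
    have \<rho>: "test_function ?\<rho> ?\<rho>'"
      unfolding test_function_def using d c pq 0
      by (intro conjI allI exI[of _ p] exI[of _ q]) (auto simp: not_le)
    have part: "set_integrable lborel {0<..} (\<lambda>x. - (\<sigma>\<^sup>2 / 2) * g x * (2 * x * ?\<rho> x + x\<^sup>2 * ?\<rho>' x) - c * v x * ?\<rho> x + f x * ?\<rho> x)"
      if g: "set_integrable lborel {p..q} g" and v: "continuous_on {0<..} v" for g v
    proof -
      have eq: "indicator {0<..} x *\<^sub>R (- (\<sigma>\<^sup>2 / 2) * g x * (2 * x * ?\<rho> x + x\<^sup>2 * ?\<rho>' x) - c * v x * ?\<rho> x + f x * ?\<rho> x)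
          = indicator {p..q} x *\<^sub>R (g x * (- (\<sigma>\<^sup>2 / 2) * \<zeta>' x)) + indicator {p..q} x *\<^sub>R ((f x - c * v x) * \<zeta> x / x\<^sup>2)" for x
      proof (cases "x \<in> {p..q}")
        case True
        then have "2 * x * ?\<rho> x + x\<^sup>2 * ?\<rho>' x = \<zeta>' x"
          using pq by (simp add: field_simps power_numeral_reduce)
        then show ?thesis using True pq by (simp add: algebra_simps diff_divide_distrib)
      next
        case False
        then show ?thesis using 0[of x] by (auto simp: indicator_def)
      qed
      have "set_integrable lborel {p..q} (\<lambda>x. g x * (- (\<sigma>\<^sup>2 / 2) * \<zeta>' x))"
      proof -
        have "compact ((\<lambda>x. - (\<sigma>\<^sup>2 / 2) * \<zeta>' x) ` {p..q})"
          by (intro compact_continuous_image continuous_intros c\<zeta>') auto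
        from compact_imp_bounded[OF this]
        obtain B where "\<forall>y\<in>(\<lambda>x. - (\<sigma>\<^sup>2 / 2) * \<zeta>' x) ` {p..q}. norm y \<le> B"
          unfolding bounded_iff by blast
        then have B: "\<bar>- (\<sigma>\<^sup>2 / 2) * \<zeta>' x\<bar> \<le> B" if "x \<in> {p..q}" for x
          using that by (metis imageI real_norm_def)
        show ?thesis
        proof (rule set_integrable_bound)
          show "set_integrable lborel {p..q} (\<lambda>x. B * g x)" using g by simp
          have [measurable]: "\<zeta>' \<in> borel_measurable borel"
            by (rule borel_measurable_continuous_onI[OF c\<zeta>'])
          have "(\<lambda>x. (indicator {p..q} x *\<^sub>R g x) * (- (\<sigma>\<^sup>2 / 2) * \<zeta>' x)) \<in> borel_measurable lborel"
            using borel_measurable_integrable[OF g[unfolded set_integrable_def]] by measurable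
          then show "set_borel_measurable lborel {p..q} (\<lambda>x. g x * (- (\<sigma>\<^sup>2 / 2) * \<zeta>' x))"
            by (simp add: set_borel_measurable_def mult_ac)
          have "\<bar>g x * (- (\<sigma>\<^sup>2 / 2) * \<zeta>' x)\<bar> \<le> \<bar>B * g x\<bar>" if "x \<in> {p..q}" for x
          proof -
            have "\<bar>g x * (- (\<sigma>\<^sup>2 / 2) * \<zeta>' x)\<bar> = \<bar>- (\<sigma>\<^sup>2 / 2) * \<zeta>' x\<bar> * \<bar>g x\<bar>"
              by (simp only: abs_mult mult_ac)
            also have "\<dots> \<le> \<bar>B\<bar> * \<bar>g x\<bar>" using B[OF that] by (intro mult_right_mono) auto
            finally show ?thesis by (simp only: abs_mult)
          qed
          then show "AE x in lborel. x \<in> {p..q} \<longrightarrow> norm (g x * (- (\<sigma>\<^sup>2 / 2) * \<zeta>' x)) \<le> norm (B * g x)"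
            by (auto simp only: real_norm_def)
        qed
      qed
      moreover have "set_integrable lborel {p..q} (\<lambda>x. (f x - c * v x) * \<zeta> x / x\<^sup>2)"
        using pq by (intro borel_integrable_atLeastAtMost' continuous_intros c\<zeta>
            continuous_on_subset[OF f] continuous_on_subset[OF v]) auto
      ultimately show ?thesis
        unfolding set_integrable_def eq by (rule Bochner_Integration.integrable_add)
    qed
    let ?F = "\<lambda>g v x. - (\<sigma>\<^sup>2 / 2) * g x * (2 * x * ?\<rho> x + x\<^sup>2 * ?\<rho>' x) - c * v x * ?\<rho> x + f x * ?\<rho> x"
    have "0 = (LINT x:{0<..}|lborel. ?F k w x) - (LINT x:{0<..}|lborel. ?F g v x)"
      using g(4)[OF \<rho>] k(4)[OF \<rho>] by simp
    also have "\<dots> = (LINT x:{0<..}|lborel. ?F k w x - ?F g v x)"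
      by (rule set_integral_diff(2)[symmetric]; rule part) (use g k pq in auto)
    also have "\<dots> = (LINT x:{0<..}|lborel. \<sigma>\<^sup>2 / 2 * (g x - k x) * \<zeta>' x + c * (v x - w x) / x\<^sup>2 * \<zeta> x)"
    proof (intro set_lebesgue_integral_cong allI impI)
      fix x :: real assume "x \<in> {0<..}"
      then have *: "2 * x * ?\<rho> x + x\<^sup>2 * ?\<rho>' x = \<zeta>' x"
        by (simp add: field_simps power_numeral_reduce)
      show "?F k w x - ?F g v x = \<sigma>\<^sup>2 / 2 * (g x - k x) * \<zeta>' x + c * (v x - w x) / x\<^sup>2 * \<zeta> x"
        unfolding * by (simp add: algebra_simps diff_divide_distrib)
    qed simp
    finally show ?thesis by simp
  qed
  moreover have "set_integrable lborel {p..q} (\<lambda>x. g x - k x)" if "0 < p" "p \<le> q" for p q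
    using g(1) k(1) that by (intro set_integral_diff)
  moreover have "(v q - w q) - (v p - w p) = (LINT x:{p..q}|lborel. g x - k x)" if "0 < p" "p \<le> q" for p q
    using g(1,2)[OF that] k(1,2)[OF that] by (simp add: set_integral_diff(2))
  moreover have "continuous_on {0<..} (\<lambda>x. v x - w x)"
    using g(3) k(3) by (intro continuous_intros)
  ultimately show thesis by (intro that[of "\<lambda>x. g x - k x"])
qed

lemma antiderivative_on_positive_reals:
  fixes f :: "real \<Rightarrow> real"
  assumes "continuous_on {0<..} f"
  obtains F where "\<And>x. 0 < x \<Longrightarrow> (F has_real_derivative f x) (at x)"
proof -
  have "isCont f x" if "0 < x" for x
    using assms that by (simp add: continuous_on_eq_continuous_at)
  then have "\<exists>F. \<forall>x. 0 < ereal x \<longrightarrow> ereal x < \<infinity> \<longrightarrow> (F has_vector_derivative f x) (at x)"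
    by (intro einterval_antiderivative) (simp_all add: zero_ereal_def)
  then obtain F where F: "\<And>x. 0 < ereal x \<Longrightarrow> ereal x < \<infinity> \<Longrightarrow> (F has_vector_derivative f x) (at x)"
    by blast
  have "(F has_real_derivative f x) (at x)" if "0 < x" for x
    using F[of x] that by (simp add: has_real_derivative_iff_has_vector_derivative)
  then show thesis by (rule that)
qed

text \<open>
  Let \<open>D\<close> be a primitive of \<open>c d / x\<^sup>2\<close>. Integration by parts turns the equation into the
  orthogonality of \<open>\<sigma>\<^sup>2 / 2 g - D\<close> to all derivatives of test functions. By the lemma of du
  Bois-Reymond this function has the integrals of a constant, so \<open>d\<close> is an integral of the
  continuously differentiable function \<open>(D + m) / (\<sigma>\<^sup>2 / 2)\<close>.
\<close>

lemma homogeneous_weak_solution_smooth: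
  fixes d g :: "real \<Rightarrow> real"
  assumes \<sigma>: "0 < \<sigma>"
    and g: "\<And>p q. 0 < p \<Longrightarrow> p \<le> q \<Longrightarrow> set_integrable lborel {p..q} g"
    and d: "\<And>p q. 0 < p \<Longrightarrow> p \<le> q \<Longrightarrow> d q - d p = (LINT x:{p..q}|lborel. g x)"
    and cont: "continuous_on {0<..} d"
    and eq: "\<And>\<zeta> \<zeta>'. test_function \<zeta> \<zeta>' \<Longrightarrow>
       (LINT x:{0<..}|lborel. \<sigma>\<^sup>2 / 2 * g x * \<zeta>' x + c * d x / x\<^sup>2 * \<zeta> x) = 0"
  obtains d' where "\<And>x. 0 < x \<Longrightarrow> (d has_real_derivative d' x) (at x)"
    "\<And>x. 0 < x \<Longrightarrow> (d' has_real_derivative c / (\<sigma>\<^sup>2 / 2) * d x / x\<^sup>2) (at x)"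
proof -
  have "continuous_on {0<..} (\<lambda>x. c * d x / x\<^sup>2)"
    using cont by (intro continuous_intros) auto
  from antiderivative_on_positive_reals[OF this]
  obtain D where D: "\<And>x. 0 < x \<Longrightarrow> (D has_real_derivative c * d x / x\<^sup>2) (at x)"
    by blast
  have cD: "continuous_on {0<..} D"
    by (rule continuous_at_imp_continuous_on) (auto intro: DERIV_isCont D)
  obtain E where E: "\<And>x. 0 < x \<Longrightarrow> (E has_real_derivative D x) (at x)"
    using antiderivative_on_positive_reals[OF cD] by blast
  have intD: "set_integrable lborel {p..q} D" if "0 < p" for p q
    using that by (intro borel_integrable_atLeastAtMost' continuous_on_subset[OF cD]) auto
  let ?h = "\<lambda>x. \<sigma>\<^sup>2 / 2 * g x - D x"
  have h: "set_integrable lborel {p..q} ?h" if "0 < p" "p \<le> q" for p q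
    using g[OF that] intD[OF that(1)] by (intro set_integral_diff) auto
  have "(LINT x:{0<..}|lborel. ?h x * \<zeta>' x) = 0" if t: "test_function \<zeta> \<zeta>'" for \<zeta> \<zeta>'
  proof -
    obtain p q where pq: "0 < p" "p < q" and 0: "\<And>x. x \<notin> {p<..<q} \<Longrightarrow> \<zeta> x = 0 \<and> \<zeta>' x = 0"
      using test_function_support[OF t] by blast
    have \<zeta>: "(\<zeta> has_real_derivative \<zeta>' x) (at x)" for x using t by (simp add: test_function_def)
    have c\<zeta>': "continuous_on X \<zeta>'" for X
      using t by (auto simp: test_function_def intro: continuous_on_subset)
    have c\<zeta>: "continuous_on X \<zeta>" for X
      by (rule continuous_at_imp_continuous_on) (blast intro: DERIV_isCont \<zeta>)
    let ?P = "\<lambda>x. c * d x / x\<^sup>2 * \<zeta> x + D x * \<zeta>' x"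
    have P: "set_integrable lborel {p..q} ?P"
      using pq by (intro borel_integrable_atLeastAtMost' continuous_intros c\<zeta> c\<zeta>'
          continuous_on_subset[OF cont] continuous_on_subset[OF cD]) auto
    have "(?P has_integral (D q * \<zeta> q - D p * \<zeta> p)) {p..q}"
    proof (rule fundamental_theorem_of_calculus)
      fix x assume "x \<in> {p..q}"
      then have "0 < x" using pq by simp
      then have "((\<lambda>x. D x * \<zeta> x) has_real_derivative D x * \<zeta>' x + c * d x / x\<^sup>2 * \<zeta> x) (at x)"
        by (intro DERIV_mult' D \<zeta>)
      then show "((\<lambda>x. D x * \<zeta> x) has_vector_derivative ?P x) (at x within {p..q})"
        unfolding has_real_derivative_iff_has_vector_derivative[symmetric]
        by (rule has_field_derivative_at_within[OF DERIV_cong]) (simp only: add.commute)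
    qed (use pq in simp)
    then have P0: "(LINT x:{p..q}|lborel. ?P x) = 0"
      using 0[of p] 0[of q] P by (simp add: set_borel_integral_eq_integral(2) integral_unique)
    have P': "integrable lborel (\<lambda>x. indicator {0<..} x *\<^sub>R ?P x)"
      "(LINT x:{0<..}|lborel. ?P x) = 0"
    proof -
      have "indicator {0<..} x *\<^sub>R ?P x = indicator {p..q} x *\<^sub>R ?P x" for x
        using 0[of x] pq by (auto simp: indicator_def)
      then show "integrable lborel (\<lambda>x. indicator {0<..} x *\<^sub>R ?P x)" "(LINT x:{0<..}|lborel. ?P x) = 0"
        using P P0 by (simp_all only: set_integrable_def set_lebesgue_integral_def)
    qed
    have "(LINT x:{0<..}|lborel. ?h x * \<zeta>' x) =
        (LINT x:{0<..}|lborel. (\<sigma>\<^sup>2 / 2 * g x * \<zeta>' x + c * d x / x\<^sup>2 * \<zeta> x) - ?P x)"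
      by (simp add: algebra_simps)
    also have "\<dots> = 0"
    proof (cases "set_integrable lborel {0<..} (\<lambda>x. \<sigma>\<^sup>2 / 2 * g x * \<zeta>' x + c * d x / x\<^sup>2 * \<zeta> x)")
      case True
      then show ?thesis
        using P' eq[OF t] by (subst set_integral_diff(2)) (auto simp: set_integrable_def)
    next
      case False
      have "\<not> set_integrable lborel {0<..}
          (\<lambda>x. (\<sigma>\<^sup>2 / 2 * g x * \<zeta>' x + c * d x / x\<^sup>2 * \<zeta> x) - ?P x)" (is "\<not> set_integrable _ _ ?G")
      proof
        assume "set_integrable lborel {0<..} ?G"
        from set_integral_add(1)[OF this, of ?P] P' False show False
          by (simp add: set_integrable_def)
      qed
      then show ?thesis
        by (simp add: set_lebesgue_integral_def set_integrable_def not_integrable_integral_eq)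
    qed
    finally show ?thesis .
  qed
  note orth = this
  define m where "m = (LINT x:{1..2}|lborel. ?h x)"
  have m: "(LINT x:{p..q}|lborel. ?h x) = m * (q - p)" if "0 < p" "p \<le> q" for p q
    unfolding m_def by (rule du_bois_reymond[OF h orth that])
  have incr: "\<sigma>\<^sup>2 / 2 * (d q - d p) = (E q - E p) + m * (q - p)" if pq: "0 < p" "p \<le> q" for p q
  proof -
    have "(D has_integral (E q - E p)) {p..q}"
    proof (rule fundamental_theorem_of_calculus)
      fix x assume "x \<in> {p..q}"
      then have "(E has_real_derivative D x) (at x)" using pq E by simp
      then show "(E has_vector_derivative D x) (at x within {p..q})"
        unfolding has_real_derivative_iff_has_vector_derivative[symmetric]
        by (rule has_field_derivative_at_within)
    qed (use pq in simp)
    then have "(LINT x:{p..q}|lborel. D x) = E q - E p"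
      using intD[OF pq(1)] by (simp add: set_borel_integral_eq_integral(2) integral_unique)
    moreover have "(LINT x:{p..q}|lborel. ?h x) = \<sigma>\<^sup>2 / 2 * (d q - d p) - (LINT x:{p..q}|lborel. D x)"
      using g[OF pq] intD[OF pq(1)] d[OF pq] by (subst set_integral_diff(2)) auto
    ultimately show ?thesis using m[OF pq] by simp
  qed
  define d' where "d' x = (D x + m) / (\<sigma>\<^sup>2 / 2)" for x
  have dE: "d x = d 1 + (E x - E 1 + m * (x - 1)) / (\<sigma>\<^sup>2 / 2)" if "0 < x" for x
  proof -
    have "\<sigma>\<^sup>2 / 2 * (d x - d 1) = E x - E 1 + m * (x - 1)"
    proof (cases "1 \<le> x")
      case True
      then show ?thesis using incr[of 1 x] by simp
    next
      case False
      then have "\<sigma>\<^sup>2 / 2 * (d 1 - d x) = E 1 - E x + m * (1 - x)"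
        using incr[of x 1] that by simp
      moreover have "\<sigma>\<^sup>2 / 2 * (d x - d 1) = - (\<sigma>\<^sup>2 / 2 * (d 1 - d x))"
        "m * (x - 1) = - (m * (1 - x))" by (simp_all only: mult_minus_right[symmetric] minus_diff_eq)
      ultimately show ?thesis by linarith
    qed
    then have "d x - d 1 = (E x - E 1 + m * (x - 1)) / (\<sigma>\<^sup>2 / 2)"
      using \<sigma> by (simp add: field_simps)
    then show ?thesis by simp
  qed
  have "(d has_real_derivative d' x) (at x)" if x: "0 < x" for x
  proof -
    have "((\<lambda>x. d 1 + (E x - E 1 + m * (x - 1)) / (\<sigma>\<^sup>2 / 2)) has_real_derivative d' x) (at x)"
    proof -
      have "((\<lambda>x. d 1 + (E x - E 1 + m * (x - 1)) / (\<sigma>\<^sup>2 / 2)) has_real_derivative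
          0 + (D x - 0 + m * (1 - 0)) / (\<sigma>\<^sup>2 / 2)) (at x)"
        by (intro DERIV_add DERIV_const DERIV_cdivide DERIV_diff DERIV_cmult DERIV_ident E x)
      then show ?thesis by (simp add: d'_def)
    qed
    then show ?thesis
    proof (rule has_field_derivative_transform_within_open[where S = "{0<..}"])
      fix y :: real assume "y \<in> {0<..}"
      then show "d 1 + (E y - E 1 + m * (y - 1)) / (\<sigma>\<^sup>2 / 2) = d y"
        by (intro dE[symmetric]) simp
    qed (use x in auto)
  qed
  moreover have "(d' has_real_derivative c / (\<sigma>\<^sup>2 / 2) * d x / x\<^sup>2) (at x)" if x: "0 < x" for x
  proof -
    have "((\<lambda>x. (D x + m) / (\<sigma>\<^sup>2 / 2)) has_real_derivative (c * d x / x\<^sup>2 + 0) / (\<sigma>\<^sup>2 / 2)) (at x)"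
      by (intro DERIV_add DERIV_const DERIV_cdivide D x)
    then show ?thesis by (simp add: d'_def[abs_def] mult_ac)
  qed
  ultimately show thesis by (rule that)
qed

section \<open>The resolvent equation: uniqueness under linear growth\<close>

text \<open>
  The left-hand side is the Wronskian of \<open>d\<close> and the solution \<open>x\<^sup>b\<close>.
\<close>

lemma euler_equation_first_integral:
  fixes d d' :: "real \<Rightarrow> real"
  assumes d: "\<And>x. 0 < x \<Longrightarrow> (d has_real_derivative d' x) (at x)"
    and d': "\<And>x. 0 < x \<Longrightarrow> (d' has_real_derivative b * (b - 1) * d x / x\<^sup>2) (at x)"
    and x: "0 < x"
  shows "x powr b * d' x - b * x powr (b - 1) * d x = d' 1 - b * d 1"
proof -
  let ?W = "\<lambda>x. x powr b * d' x - b * x powr (b - 1) * d x"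
  have "(?W has_real_derivative 0) (at y within {0<..})" if "y \<in> {0<..}" for y
  proof -
    have y: "0 < y" using that by simp
    have p: "((\<lambda>x. x powr a) has_real_derivative a * y powr (a - 1)) (at y)" for a
      using y by (auto intro!: derivative_eq_intros)
    have "(?W has_real_derivative
        (y powr b * (b * (b - 1) * d y / y\<^sup>2) + b * y powr (b - 1) * d' y) -
        (b * y powr (b - 1) * d' y + b * ((b - 1) * y powr (b - 1 - 1)) * d y)) (at y)"
      by (intro DERIV_diff DERIV_mult' DERIV_cmult p d d' y)
    also have "y powr (b - 1 - 1) = y powr b / y\<^sup>2"
      using powr_diff[of y b 2] powr_numeral[of y "num.Bit0 num.One"] y by simp
    also have "(y powr b * (b * (b - 1) * d y / y\<^sup>2) + b * y powr (b - 1) * d' y) -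
        (b * y powr (b - 1) * d' y + b * ((b - 1) * (y powr b / y\<^sup>2)) * d y) = 0"
      by simp
    finally show ?thesis by (rule has_field_derivative_at_within)
  qed
  then obtain C where C: "\<And>y. y \<in> {0<..} \<Longrightarrow> ?W y = C"
    using has_field_derivative_zero_constant[of "{0<..}" ?W] convex_real_interval(3)[of 0] by blast
  have "?W x = ?W 1"
    using C[of x] C[of 1] x by simp
  then show ?thesis by simp
qed

text \<open>
  The first integrals for the exponents \<open>b\<close> and \<open>1 - b\<close> determine \<open>d\<close> without its derivative, as
  \<open>B x\<^sup>b - A x\<^sup>1\<^sup>-\<^sup>b\<close>. Linear growth at infinity forces \<open>B = 0\<close>, and boundedness near 0 forces \<open>A = 0\<close>.
\<close>

lemma euler_equation_linear_growth_eq_0: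
  fixes d d' :: "real \<Rightarrow> real"
  assumes b: "1 < b"
    and d: "\<And>x. 0 < x \<Longrightarrow> (d has_real_derivative d' x) (at x)"
    and d': "\<And>x. 0 < x \<Longrightarrow> (d' has_real_derivative b * (b - 1) * d x / x\<^sup>2) (at x)"
    and growth: "linear_growth d" and x: "0 < x"
  shows "d x = 0"
proof -
  define A where "A = (d' 1 - b * d 1) / (2 * b - 1)"
  define B where "B = (d' 1 - (1 - b) * d 1) / (2 * b - 1)"
  have form: "d x = B * x powr b - A * x powr (1 - b)" if x: "0 < x" for x
  proof -
    have 1: "x powr b * d' x - b * x powr (b - 1) * d x = d' 1 - b * d 1"
      by (rule euler_equation_first_integral[OF d d' x])
    have 2: "x powr (1 - b) * d' x - (1 - b) * x powr (1 - b - 1) * d x = d' 1 - (1 - b) * d 1"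
      by (rule euler_equation_first_integral[OF d _ x]) (use d' in \<open>auto simp: algebra_simps\<close>)
    have p: "x powr b * x powr (1 - b) = x" "x powr (b - 1) * x powr (1 - b) = 1"
       "x powr (1 - b - 1) * x powr b = 1"
      using x by (simp_all add: powr_add[symmetric])
    have "(d' 1 - (1 - b) * d 1) * x powr b - (d' 1 - b * d 1) * x powr (1 - b) =
       (x powr b * x powr (1 - b)) * d' x - (1 - b) * (x powr (1 - b - 1) * x powr b) * d x
       - (x powr b * x powr (1 - b)) * d' x + b * (x powr (b - 1) * x powr (1 - b)) * d x"
      unfolding 1[symmetric] 2[symmetric] by (simp add: algebra_simps)
    also have "\<dots> = (2 * b - 1) * d x" unfolding p by (simp add: algebra_simps)
    finally have "d x = ((d' 1 - (1 - b) * d 1) * x powr b - (d' 1 - b * d 1) * x powr (1 - b)) / (2 * b - 1)"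
      using b by (simp add: eq_divide_eq mult.commute)
    then show ?thesis
      unfolding A_def B_def times_divide_eq_left diff_divide_distrib[symmetric] .
  qed
  obtain C where C: "\<And>x. 0 < x \<Longrightarrow> \<bar>d x\<bar> \<le> C * (1 + x)"
    using growth by (auto simp: linear_growth_def)
  have p0: "((\<lambda>y. y powr (- a)) \<longlongrightarrow> 0) at_top" if "0 < a" for a :: real
    using that by (intro tendsto_neg_powr) (auto intro: filterlim_ident)
  have "((\<lambda>y. C * (y powr (- b) + y powr (- (b - 1))) + \<bar>A\<bar> * y powr (- (2 * b - 1))) \<longlongrightarrow> C * (0 + 0) + \<bar>A\<bar> * 0) at_top"
    using b by (intro tendsto_intros p0) auto
  moreover have "\<forall>\<^sub>F y in at_top. \<bar>B\<bar> \<le> C * (y powr (- b) + y powr (- (b - 1))) + \<bar>A\<bar> * y powr (- (2 * b - 1))"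
    using eventually_gt_at_top[of 0]
  proof eventually_elim
    case (elim y)
    have "B = y powr (- b) * d y + A * y powr (- (2 * b - 1))"
    proof -
      have q: "y powr (- b) * y powr b = 1" "y powr (- b) * y powr (1 - b) = y powr (- (2 * b - 1))"
        using elim by (simp_all add: powr_add[symmetric])
      have "y powr (- b) * d y = B * (y powr (- b) * y powr b) - A * (y powr (- b) * y powr (1 - b))"
        unfolding form[OF elim] by (simp only: right_diff_distrib mult_ac)
      then show ?thesis unfolding q by simp
    qed
    then have "\<bar>B\<bar> \<le> y powr (- b) * \<bar>d y\<bar> + \<bar>A\<bar> * y powr (- (2 * b - 1))"
      using abs_triangle_ineq[of "y powr (- b) * d y" "A * y powr (- (2 * b - 1))"]
      by (simp add: abs_mult)
    also have "y powr (- b) * \<bar>d y\<bar> \<le> y powr (- b) * (C * (1 + y))"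
      using C[OF elim] by (intro mult_left_mono) auto
    also have "\<dots> = C * (y powr (- b) + y powr (- (b - 1)))"
    proof -
      have "y powr (- b) * y powr 1 = y powr (- (b - 1))"
        by (simp only: powr_add[symmetric]) simp
      then have "y powr (- b) * y = y powr (- (b - 1))" using elim by simp
      moreover have "y powr (- b) * (C * (1 + y)) = C * (y powr (- b) + y powr (- b) * y)"
        by (simp add: algebra_simps)
      ultimately show ?thesis by simp
    qed
    finally show ?case by simp
  qed
  ultimately have "\<bar>B\<bar> \<le> C * (0 + 0) + \<bar>A\<bar> * 0"
    by (rule tendsto_lowerbound) simp
  then have B: "B = 0" by simp
  have "((\<lambda>y. C * (y powr (- (b - 1)) + y powr (- b))) \<longlongrightarrow> C * (0 + 0)) at_top"
    using b by (intro tendsto_intros p0) auto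
  moreover have "\<forall>\<^sub>F y in at_top. \<bar>A\<bar> \<le> C * (y powr (- (b - 1)) + y powr (- b))"
    using eventually_gt_at_top[of 0]
  proof eventually_elim
    case (elim y)
    \<comment> \<open>The behaviour at 0 is studied at \<open>1 / y\<close> as \<open>y\<close> tends to infinity.\<close>
    have y: "0 < 1 / y" using elim by simp
    have "(1 / y) powr (1 - b) = y powr (b - 1)"
      using elim by (simp add: powr_divide powr_minus_divide[symmetric])
    then have "d (1 / y) = - (A * y powr (b - 1))"
      using form[OF y] B by simp
    moreover have "y powr (- (b - 1)) * y powr (b - 1) = 1"
      using elim by (simp only: powr_add[symmetric]) simp
    ultimately have "y powr (- (b - 1)) * d (1 / y) = - A"
      by (metis (no_types, lifting) mult.commute mult.right_neutral mult_minus_right mult.assoc)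
    then have "\<bar>A\<bar> = \<bar>y powr (- (b - 1)) * d (1 / y)\<bar>" by simp
    also have "\<dots> = y powr (- (b - 1)) * \<bar>d (1 / y)\<bar>" by (simp add: abs_mult)
    also have "\<dots> \<le> y powr (- (b - 1)) * (C * (1 + 1 / y))"
      using C[OF y] by (intro mult_left_mono) auto
    also have "\<dots> = C * (y powr (- (b - 1)) + y powr (- b))"
    proof -
      have "y powr (- (b - 1)) / y powr 1 = y powr (- b)"
        by (simp only: powr_diff[symmetric]) simp
      then have "y powr (- (b - 1)) / y = y powr (- b)" using elim by simp
      moreover have "y powr (- (b - 1)) * (C * (1 + 1 / y)) = C * (y powr (- (b - 1)) + y powr (- (b - 1)) / y)"
        by (simp add: algebra_simps)
      ultimately show ?thesis by simp
    qed
    finally show ?case .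
  qed
  ultimately have "\<bar>A\<bar> \<le> C * (0 + 0)"
    by (rule tendsto_lowerbound) simp
  then have "A = 0" by simp
  with B form[OF x] show ?thesis by simp
qed

theorem weak_solution_unique:
  assumes \<sigma>: "0 < \<sigma>" and b: "1 < b"
  defines "c \<equiv> \<sigma>\<^sup>2 / 2 * (b * (b - 1))"
  assumes v: "weak_solution \<sigma> c f v" "linear_growth v"
    and w: "weak_solution \<sigma> c f w" "linear_growth w"
    and f: "continuous_on {0<..} f" and x: "0 < x"
  shows "v x = w x"
proof -
  obtain g where "\<And>p q. 0 < p \<Longrightarrow> p \<le> q \<Longrightarrow> set_integrable lborel {p..q} g"
    "\<And>p q. 0 < p \<Longrightarrow> p \<le> q \<Longrightarrow> (v q - w q) - (v p - w p) = (LINT x:{p..q}|lborel. g x)"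
    "continuous_on {0<..} (\<lambda>x. v x - w x)"
    "\<And>\<zeta> \<zeta>'. test_function \<zeta> \<zeta>' \<Longrightarrow>
       (LINT x:{0<..}|lborel. \<sigma>\<^sup>2 / 2 * g x * \<zeta>' x + c * (v x - w x) / x\<^sup>2 * \<zeta> x) = 0"
    using weak_solution_difference[OF v(1) w(1) f] by blast
  from homogeneous_weak_solution_smooth[OF \<sigma> this]
  obtain d' where d': "\<And>x. 0 < x \<Longrightarrow> ((\<lambda>x. v x - w x) has_real_derivative d' x) (at x)"
    "\<And>x. 0 < x \<Longrightarrow> (d' has_real_derivative c / (\<sigma>\<^sup>2 / 2) * (v x - w x) / x\<^sup>2) (at x)"
    by blast
  have c: "c / (\<sigma>\<^sup>2 / 2) = b * (b - 1)" using \<sigma> by (simp add: c_def)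
  have "linear_growth (\<lambda>x. v x - w x)"
  proof -
    obtain C C' where "\<forall>x>0. \<bar>v x\<bar> \<le> C * (1 + x)" "\<forall>x>0. \<bar>w x\<bar> \<le> C' * (1 + x)"
      using v(2) w(2) by (auto simp: linear_growth_def)
    then have "\<forall>x>0. \<bar>v x - w x\<bar> \<le> (C + C') * (1 + x)"
      by (smt (verit) distrib_right)
    then show ?thesis by (auto simp: linear_growth_def)
  qed
  from euler_equation_linear_growth_eq_0[OF b d'(1) d'(2)[unfolded c] this x]
  show ?thesis by simp
qed

section \<open>Uniqueness of Laplace transforms\<close>

lemma real_polynomial_function_power_sum:
  assumes "real_polynomial_function (g :: real \<Rightarrow> real)"
  obtains a n where "g = (\<lambda>x. \<Sum>i\<le>n. a i * x ^ i)"
  using assms by (metis real_polynomial_function_iff_sum)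

text \<open>
  By the Weierstrass theorem \<open>k\<close> is orthogonal to \<open>f (exp (- t))\<close> for every continuous \<open>f\<close>. Letting \<open>f\<close>
  approach the indicator of \<open>{..<exp (- s)}\<close> shows that \<open>k\<close> has integral 0 over every \<open>{s<..}\<close>. So the
  positive and the negative part of \<open>k\<close> are the densities of the same measure.
\<close>

lemma AE_eq_0_if_exp_moments_0:
  fixes k :: "real \<Rightarrow> real"
  assumes k: "integrable lborel k" and supp: "\<And>t. t < 0 \<Longrightarrow> k t = 0"
    and moments: "\<And>n::nat. (LINT t|lborel. k t * exp (- t) ^ n) = 0"
  shows "AE t in lborel. k t = 0"
proof -
  have [measurable]: "k \<in> borel_measurable borel"
    using borel_measurable_integrable[OF k] by simp
  have bound: "integrable lborel (\<lambda>t. k t * f (exp (- t)))"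
    if [measurable]: "f \<in> borel_measurable borel" and B: "\<And>x. x \<in> {0..1} \<Longrightarrow> \<bar>f x\<bar> \<le> B" for f :: "real \<Rightarrow> real" and B
  proof (rule Bochner_Integration.integrable_bound)
    show "integrable lborel (\<lambda>t. B * k t)" using k by simp
    have "\<bar>k t * f (exp (- t))\<bar> \<le> \<bar>B * k t\<bar>" for t
    proof (cases "t < 0")
      case False
      then have "\<bar>f (exp (- t))\<bar> \<le> \<bar>B\<bar>" using B[of "exp (- t)"] by auto
      then have "\<bar>k t\<bar> * \<bar>f (exp (- t))\<bar> \<le> \<bar>k t\<bar> * \<bar>B\<bar>" by (intro mult_left_mono) auto
      then show ?thesis by (simp add: abs_mult mult.commute)
    qed (simp add: supp)
    then show "AE t in lborel. norm (k t * f (exp (- t))) \<le> norm (B * k t)" by simp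
  qed measurable
  have cont0: "(LINT t|lborel. k t * f (exp (- t))) = 0" if f: "continuous_on UNIV f" for f :: "real \<Rightarrow> real"
  proof -
    let ?N = "LINT t|lborel. \<bar>k t\<bar>"
    have N: "0 \<le> ?N" by (rule integral_nonneg_AE) simp
    have fm [measurable]: "f \<in> borel_measurable borel" using f by (rule borel_measurable_continuous_onI)
    have "bounded (f ` {0..1})"
      by (intro compact_imp_bounded compact_continuous_image continuous_on_subset[OF f]) auto
    then obtain B where "\<forall>x\<in>{0..1}. \<bar>f x\<bar> \<le> B"
      unfolding bounded_iff by auto
    then have B: "\<bar>f x\<bar> \<le> B" if "x \<in> {0..1}" for x using that by blast
    have "\<bar>LINT t|lborel. k t * f (exp (- t))\<bar> \<le> e * ?N" if e: "0 < e" for e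
    proof -
      obtain g where g: "real_polynomial_function g" "\<And>x. x \<in> {0..1} \<Longrightarrow> \<bar>f x - g x\<bar> < e"
        using Stone_Weierstrass_real_polynomial_function[of "{0..1::real}" f e] e
          continuous_on_subset[OF f] by auto
      obtain a n where gs: "g = (\<lambda>x. \<Sum>i\<le>n. a i * x ^ i)"
        using real_polynomial_function_power_sum[OF g(1)] .
      have pow: "integrable lborel (\<lambda>t. k t * exp (- t) ^ i)" for i :: nat
        by (rule bound[of "\<lambda>x. x ^ i" 1]) (auto simp: power_le_one)
      have kg: "k t * g (exp (- t)) = (\<Sum>i\<le>n. a i * (k t * exp (- t) ^ i))" for t
        by (simp add: gs sum_distrib_left mult_ac)
      have ig: "integrable lborel (\<lambda>t. k t * g (exp (- t)))"
        unfolding kg by (intro Bochner_Integration.integrable_sum integrable_mult_right pow)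
      have "(LINT t|lborel. k t * g (exp (- t))) = 0"
        unfolding kg by (subst Bochner_Integration.integral_sum) (auto intro!: integrable_mult_right pow simp: moments)
      then have "(LINT t|lborel. k t * f (exp (- t))) = (LINT t|lborel. k t * f (exp (- t)) - k t * g (exp (- t)))"
        using ig bound[OF fm B] by (subst Bochner_Integration.integral_diff) auto
      also have "\<bar>\<dots>\<bar> \<le> (LINT t|lborel. e * \<bar>k t\<bar>)"
      proof (rule order_trans[OF integral_abs_bound integral_mono])
        show "integrable lborel (\<lambda>t. \<bar>k t * f (exp (- t)) - k t * g (exp (- t))\<bar>)"
          using ig bound[OF fm B] by (intro integrable_abs Bochner_Integration.integrable_diff)
        show "integrable lborel (\<lambda>t. e * \<bar>k t\<bar>)" using k by simp
        fix t
        show "\<bar>k t * f (exp (- t)) - k t * g (exp (- t))\<bar> \<le> e * \<bar>k t\<bar>"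
        proof (cases "t < 0")
          case False
          then have "\<bar>f (exp (- t)) - g (exp (- t))\<bar> \<le> e" using g(2)[of "exp (- t)"] by simp
          then have "\<bar>k t\<bar> * \<bar>f (exp (- t)) - g (exp (- t))\<bar> \<le> \<bar>k t\<bar> * e" by (intro mult_left_mono) auto
          then show ?thesis by (simp add: abs_mult[symmetric] right_diff_distrib mult.commute)
        qed (simp add: supp)
      qed
      finally show ?thesis by simp
    qed
    then have "\<bar>LINT t|lborel. k t * f (exp (- t))\<bar> \<le> 0 + e" if "0 < e" for e
    proof -
      have "\<bar>LINT t|lborel. k t * f (exp (- t))\<bar> \<le> e / (?N + 1) * ?N"
        using \<open>\<And>e. 0 < e \<Longrightarrow> \<bar>LINT t|lborel. k t * f (exp (- t))\<bar> \<le> e * ?N\<close>[of "e / (?N + 1)"] that N by simp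
      also have "\<dots> = e * (?N / (?N + 1))" by simp
      also have "\<dots> \<le> e * 1"
      proof (rule mult_left_mono)
        have "0 < ?N + 1" using N by linarith
        then show "?N / (?N + 1) \<le> 1" by (subst divide_le_eq_1_pos) linarith+
      qed (use that in simp)
      finally show ?thesis by simp
    qed
    then have "\<bar>LINT t|lborel. k t * f (exp (- t))\<bar> \<le> 0" by (rule field_le_epsilon)
    then show ?thesis by simp
  qed
  have tail: "(LINT t|lborel. k t * indicator {s<..} t) = 0" for s
  proof -
    \<comment> \<open>These tend to the indicator of \<open>{..<exp (- s)}\<close>, that is, of \<open>s < t\<close> at \<open>x = exp (- t)\<close>.\<close>
    let ?f = "\<lambda>n::nat. \<lambda>x. min 1 (max 0 (real n * (exp (- s) - x)))"
    have "(\<lambda>n. LINT t|lborel. k t * ?f n (exp (- t))) \<longlonglongrightarrow> (LINT t|lborel. k t * indicator {s<..} t)"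
    proof (rule integral_dominated_convergence[where w = "\<lambda>t. \<bar>k t\<bar>"])
      show "AE t in lborel. (\<lambda>n. k t * ?f n (exp (- t))) \<longlonglongrightarrow> k t * indicator {s<..} t"
      proof (intro AE_I2 tendsto_intros)
        fix t
        show "(\<lambda>n. ?f n (exp (- t))) \<longlonglongrightarrow> indicator {s<..} t"
        proof (cases "s < t")
          case True
          define \<delta> where "\<delta> = exp (- s) - exp (- t)"
          have "0 < \<delta>" using True by (simp add: \<delta>_def)
          obtain N :: nat where "1 / \<delta> < real N" using reals_Archimedean2 by blast
          then have N: "1 \<le> real n * \<delta>" if "N \<le> n" for n
          proof -
            have "1 / \<delta> \<le> real n" using \<open>1 / \<delta> < real N\<close> that by linarith
            then show ?thesis using \<open>0 < \<delta>\<close> by (simp add: field_simps)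
          qed
          have "\<forall>\<^sub>F n in sequentially. ?f n (exp (- t)) = indicator {s<..} t"
            using eventually_ge_at_top[of N]
          proof eventually_elim
            case (elim n)
            from N[OF this] True show ?case by (simp add: \<delta>_def[symmetric])
          qed
          then show ?thesis by (rule tendsto_eventually)
        next
          case False
          have "?f n (exp (- t)) = indicator {s<..} t" for n
          proof -
            have "real n * (exp (- s) - exp (- t)) \<le> 0"
              using False by (intro mult_nonneg_nonpos) auto
            then show ?thesis using False by simp
          qed
          then show ?thesis by simp
        qed
      qed
      show "AE t in lborel. norm (k t * ?f n (exp (- t))) \<le> \<bar>k t\<bar>" for n
        by (auto simp: abs_mult intro!: mult_left_le)
    qed (use k in auto)
    moreover have "(LINT t|lborel. k t * ?f n (exp (- t))) = 0" for n
      by (rule cont0) (intro continuous_intros)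
    ultimately show ?thesis by (simp add: LIMSEQ_const_iff)
  qed
  let ?p = "\<lambda>t. ennreal (k t)" and ?m = "\<lambda>t. ennreal (- k t)"
  have ik: "integrable lborel (\<lambda>t. k t * indicator A t)" if "A \<in> sets borel" for A :: "real set"
    using integrable_real_mult_indicator[of A lborel k] k that by simp
  have fin: "(\<integral>\<^sup>+t. ?p t \<partial>lborel) < \<infinity>" "(\<integral>\<^sup>+t. ?m t \<partial>lborel) < \<infinity>"
    using k by (auto simp: real_integrable_def top.not_eq_extremum)
  have "density lborel ?p = density lborel ?m"
  proof (rule measure_eqI_lessThan)
    fix s :: real
    have ep: "emeasure (density lborel ?p) {s<..} = (\<integral>\<^sup>+t. ennreal (k t * indicator {s<..} t) \<partial>lborel)"
      by (subst emeasure_density) (auto intro!: nn_integral_cong simp: indicator_def)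
    have em: "emeasure (density lborel ?m) {s<..} = (\<integral>\<^sup>+t. ennreal (- (k t * indicator {s<..} t)) \<partial>lborel)"
      by (subst emeasure_density) (auto intro!: nn_integral_cong simp: indicator_def)
    have "integrable lborel (\<lambda>t. k t * indicator {s<..} t)" by (rule ik) simp
    from real_lebesgue_integral_def[OF this] this tail[of s]
    have e: "enn2real (\<integral>\<^sup>+t. ennreal (k t * indicator {s<..} t) \<partial>lborel) =
        enn2real (\<integral>\<^sup>+t. ennreal (- (k t * indicator {s<..} t)) \<partial>lborel)"
      and f: "(\<integral>\<^sup>+t. ennreal (k t * indicator {s<..} t) \<partial>lborel) < \<infinity>"
      "(\<integral>\<^sup>+t. ennreal (- (k t * indicator {s<..} t)) \<partial>lborel) < \<infinity>"
      by (auto simp: real_integrable_def top.not_eq_extremum)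
    show "emeasure (density lborel ?p) {s<..} < \<infinity>" unfolding ep by (rule f)
    show "emeasure (density lborel ?p) {s<..} = emeasure (density lborel ?m) {s<..}"
      unfolding ep em using e f by (metis ennreal_enn2real infinity_ennreal_def)
  qed auto
  then have "AE t in lborel. ?p t = ?m t"
    by (subst (asm) finite_density_unique) (use fin in auto)
  then show ?thesis
  proof eventually_elim
    case (elim t)
    then show ?case by (cases "0 \<le> k t") (auto simp: ennreal_neg)
  qed
qed

text \<open>
  Lerch's theorem. Along the arithmetic progression \<open>l = l0 + 1 + n\<close> the transforms of \<open>f - g\<close> are
  the moments of \<open>AE_eq_0_if_exp_moments_0\<close>. A Borel representative replaces the Lebesgue
  measurable \<open>f - g\<close>.
\<close>

theorem laplace_transform_unique:
  fixes f g :: "real \<Rightarrow> real"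
  assumes ex: "\<And>l. l0 < l \<Longrightarrow> laplace_transform_exists f l" "\<And>l. l0 < l \<Longrightarrow> laplace_transform_exists g l"
    and eq: "\<And>l. l0 < l \<Longrightarrow> laplace_transform f l = laplace_transform g l"
  shows "AE t in lebesgue. 0 \<le> t \<longrightarrow> f t = g t"
proof -
  define h where "h t = indicator {0..} t * exp (- ((l0 + 1) * t)) * (f t - g t)" for t
  have mom: "integrable lebesgue (\<lambda>t. h t * exp (- t) ^ n)" "(LINT t|lebesgue. h t * exp (- t) ^ n) = 0" for n :: nat
  proof -
    let ?l = "l0 + 1 + real n"
    have l: "l0 < ?l" by simp
    have h: "h t * exp (- t) ^ n = indicator {0..} t *\<^sub>R (exp (- (?l * t)) * f t) - indicator {0..} t *\<^sub>R (exp (- (?l * t)) * g t)" for t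
    proof -
      have "exp (- ((l0 + 1) * t)) * exp (- t) ^ n = exp (- (?l * t))"
        by (simp add: exp_of_nat_mult[symmetric] exp_add[symmetric] algebra_simps)
      then show ?thesis unfolding h_def by (simp add: algebra_simps)
    qed
    show "integrable lebesgue (\<lambda>t. h t * exp (- t) ^ n)"
      unfolding h using ex[OF l] unfolding laplace_transform_exists_def set_integrable_def
      by (rule Bochner_Integration.integrable_diff)
    show "(LINT t|lebesgue. h t * exp (- t) ^ n) = 0"
      unfolding h using ex[OF l] eq[OF l]
      unfolding laplace_transform_exists_def laplace_transform_def set_integrable_def set_lebesgue_integral_def
      by (subst Bochner_Integration.integral_diff) auto
  qed
  have "h \<in> borel_measurable lebesgue"
    using borel_measurable_integrable[OF mom(1)[of 0]] by simp
  then obtain k where k [measurable]: "k \<in> borel_measurable lborel" and hk: "AE t in lborel. h t = k t"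
    using completion_ex_borel_measurable_real by blast
  let ?k = "\<lambda>t. indicator {0..} t * k t"
  have hk': "AE t in lebesgue. h t = ?k t"
  proof (rule AE_completion)
    show "AE t in lborel. h t = ?k t"
      using hk by eventually_elim (auto simp: h_def indicator_def)
  qed
  have m [measurable]: "(\<lambda>t. ?k t * exp (- t) ^ n) \<in> borel_measurable lborel" for n by measurable
  have cong: "AE t in lebesgue. h t * exp (- t) ^ n = ?k t * exp (- t) ^ n" for n
    using hk' by eventually_elim simp
  have mom': "integrable lborel (\<lambda>t. ?k t * exp (- t) ^ n)" "(LINT t|lborel. ?k t * exp (- t) ^ n) = 0" for n :: nat
  proof -
    have mm: "(\<lambda>t. ?k t * exp (- t) ^ n) \<in> borel_measurable lebesgue"
      using m by (rule measurable_completion)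
    have "integrable lebesgue (\<lambda>t. ?k t * exp (- t) ^ n)"
      by (rule Bochner_Integration.integrable_cong_AE_imp[OF mom(1)[of n] mm cong])
    then show "integrable lborel (\<lambda>t. ?k t * exp (- t) ^ n)"
      using integrable_completion[OF m] by blast
    have "(LINT t|lborel. ?k t * exp (- t) ^ n) = (LINT t|lebesgue. ?k t * exp (- t) ^ n)"
      by (rule integral_completion[OF m, symmetric])
    also have "\<dots> = (LINT t|lebesgue. h t * exp (- t) ^ n)"
      by (rule integral_cong_AE[OF borel_measurable_integrable[OF mom(1)] mm cong, symmetric])
    finally show "(LINT t|lborel. ?k t * exp (- t) ^ n) = 0" using mom(2) by simp
  qed
  have "AE t in lborel. ?k t = 0"
    by (rule AE_eq_0_if_exp_moments_0) (use mom'(1)[of 0] mom'(2) in auto)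
  then have "AE t in lebesgue. ?k t = 0" by (rule AE_completion)
  with hk' show ?thesis
    by eventually_elim (auto simp: h_def indicator_def)
qed

section \<open>Uniqueness for the time-fractional problem\<close>

lemma euler_root_exists:
  fixes \<sigma> :: real
  assumes "0 < \<phi>" "0 < \<sigma>"
  obtains b where "1 < b" "\<sigma>\<^sup>2 / 2 * (b * (b - 1)) = \<phi>"
proof -
  \<comment> \<open>The roots of \<open>b (b - 1) = 2 \<phi> / \<sigma>\<^sup>2\<close> are \<open>1 / 2 \<plusminus> s\<close>.\<close>
  define s where "s = sqrt (1 / 4 + 2 * \<phi> / \<sigma>\<^sup>2)"
  have q: "0 < 2 * \<phi> / \<sigma>\<^sup>2" using assms by simp
  have s2: "s\<^sup>2 = 1 / 4 + 2 * \<phi> / \<sigma>\<^sup>2" using q by (simp add: s_def)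
  have "sqrt ((1 / 2)\<^sup>2) < s"
    unfolding s_def using q by (intro real_sqrt_less_mono) (simp add: power2_eq_square)
  then have "1 / 2 < s" by simp
  moreover have "(1 / 2 + s) * (1 / 2 + s - 1) = s\<^sup>2 - 1 / 4"
    by (simp add: power2_eq_square algebra_simps)
  then have "(1 / 2 + s) * (1 / 2 + s - 1) = 2 * \<phi> / \<sigma>\<^sup>2" using s2 by simp
  then have "\<sigma>\<^sup>2 / 2 * ((1 / 2 + s) * (1 / 2 + s - 1)) = \<phi>" using assms by (simp only:, simp)
  ultimately show thesis by (intro that[of "1 / 2 + s"]) auto
qed

lemma weak_solution_cong:
  assumes "weak_solution \<sigma> c f v" and "\<And>x. 0 < x \<Longrightarrow> v x = w x"
  shows "weak_solution \<sigma> c f w"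
proof -
  have eq: "(LINT x:{0<..}|lborel.
              - (\<sigma>\<^sup>2 / 2) * g x * (2 * x * \<rho> x + x\<^sup>2 * \<rho>' x) - c * w x * \<rho> x + f x * \<rho> x) =
            (LINT x:{0<..}|lborel.
              - (\<sigma>\<^sup>2 / 2) * g x * (2 * x * \<rho> x + x\<^sup>2 * \<rho>' x) - c * v x * \<rho> x + f x * \<rho> x)" for g \<rho> \<rho>'
    by (intro set_lebesgue_integral_cong) (auto simp: assms(2))
  from assms(1) obtain g where g: "set_borel_measurable lborel {0<..} g"
    "\<And>p q. 0 < p \<and> p \<le> q \<Longrightarrow> set_integrable lborel {p..q} (\<lambda>x. (g x)\<^sup>2) \<and>
           v q - v p = (LINT x:{p..q}|lborel. g x)"
    "\<And>\<rho> \<rho>'. test_function \<rho> \<rho>' \<Longrightarrow>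
           (LINT x:{0<..}|lborel.
              - (\<sigma>\<^sup>2 / 2) * g x * (2 * x * \<rho> x + x\<^sup>2 * \<rho>' x) - c * v x * \<rho> x + f x * \<rho> x) = 0"
    unfolding weak_solution_def by blast
  show ?thesis
    unfolding weak_solution_def
  proof (intro exI[of _ g] conjI allI impI)
    fix p q :: real assume pq: "0 < p \<and> p \<le> q"
    then show "w q - w p = (LINT x:{p..q}|lborel. g x)"
      using g(2)[OF pq] assms(2)[of p] assms(2)[of q] by simp
  next
    fix \<rho> \<rho>' assume "test_function \<rho> \<rho>'"
    from g(3)[OF this]
    show "(LINT x:{0<..}|lborel.
              - (\<sigma>\<^sup>2 / 2) * g x * (2 * x * \<rho> x + x\<^sup>2 * \<rho>' x) - c * w x * \<rho> x + f x * \<rho> x) = 0"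
      unfolding eq .
  qed (use g in simp_all)
qed

lemma AE_lebesgue_shift:
  fixes P :: "real \<Rightarrow> bool"
  assumes "AE t in lebesgue. P (t + a)"
  shows "AE t in lebesgue. P t"
proof -
  from assms obtain N where N: "negligible N" "{t. \<not> P (t + a)} \<subseteq> N"
    by (auto simp: eventually_ae_filter_negligible)
  have "{t. \<not> P t} \<subseteq> (+) a ` N"
  proof
    fix t assume "t \<in> {t. \<not> P t}"
    then have "t - a \<in> N" using N(2) by auto
    then show "t \<in> (+) a ` N" by (intro image_eqI[of _ _ "t - a"]) auto
  qed
  with negligible_translation[OF N(1), of a] show ?thesis
    by (auto simp: eventually_ae_filter_negligible)
qed

text \<open>
  At every large \<open>l\<close> the transforms of the two shifted solutions solve the same resolvent
  equation, whose exponent \<open>b\<close> exists because \<open>\<phi> l > 0\<close>.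
\<close>

theorem delayed_solution_unique:
  assumes \<sigma>: "0 < \<sigma>" and \<phi>: "\<And>l. 0 < l \<Longrightarrow> 0 < laplace_exponent \<kappa> \<nu> l"
    and \<psi>: "continuous_on {0<..} \<psi>"
    and u: "delayed_solution \<kappa> \<nu> \<sigma> \<psi> a u" and v: "delayed_solution \<kappa> \<nu> \<sigma> \<psi> a v"
    and x: "0 < x"
  shows "AE t in lebesgue. 0 \<le> t \<longrightarrow> v t x = u t x"
proof -
  let ?U = "\<lambda>t x. u (t + a) x" and ?V = "\<lambda>t x. v (t + a) x"
  obtain lu where lu: "0 \<le> lu" "\<And>l. lu < l \<Longrightarrow>
        (\<forall>x>0. laplace_transform_exists (\<lambda>t. ?U t x) l) \<and>
        linear_growth (\<lambda>x. laplace_transform (\<lambda>t. ?U t x) l) \<and>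
        weak_solution \<sigma> (laplace_exponent \<kappa> \<nu> l) (\<lambda>x. laplace_exponent \<kappa> \<nu> l / l * \<psi> x)
          (\<lambda>x. laplace_transform (\<lambda>t. ?U t x) l)"
    using u unfolding delayed_solution_def ivp_solution_def by blast
  obtain lv where lv: "0 \<le> lv" "\<And>l. lv < l \<Longrightarrow>
        (\<forall>x>0. laplace_transform_exists (\<lambda>t. ?V t x) l) \<and>
        linear_growth (\<lambda>x. laplace_transform (\<lambda>t. ?V t x) l) \<and>
        weak_solution \<sigma> (laplace_exponent \<kappa> \<nu> l) (\<lambda>x. laplace_exponent \<kappa> \<nu> l / l * \<psi> x)
          (\<lambda>x. laplace_transform (\<lambda>t. ?V t x) l)"
    using v unfolding delayed_solution_def ivp_solution_def by blast
  have "AE t in lebesgue. 0 \<le> t \<longrightarrow> ?V t x = ?U t x"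
  proof (rule laplace_transform_unique[of "max lu lv"])
    fix l assume l: "max lu lv < l"
    then have l': "0 < l" "lu < l" "lv < l" using lu(1) by auto
    show "laplace_transform_exists (\<lambda>t. ?V t x) l" "laplace_transform_exists (\<lambda>t. ?U t x) l"
      using lu(2)[OF l'(2)] lv(2)[OF l'(3)] x by auto
    obtain b where b: "1 < b" "\<sigma>\<^sup>2 / 2 * (b * (b - 1)) = laplace_exponent \<kappa> \<nu> l"
      using euler_root_exists[OF \<phi>[OF l'(1)] \<sigma>] .
    show "laplace_transform (\<lambda>t. ?V t x) l = laplace_transform (\<lambda>t. ?U t x) l"
    proof (rule weak_solution_unique[OF \<sigma> b(1), unfolded b(2), where x = x
          and v = "\<lambda>x. laplace_transform (\<lambda>t. ?V t x) l"
          and w = "\<lambda>x. laplace_transform (\<lambda>t. ?U t x) l"])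
      show "continuous_on {0<..} (\<lambda>x. laplace_exponent \<kappa> \<nu> l / l * \<psi> x)"
        using \<psi> by (intro continuous_intros)
    qed (use lu(2)[OF l'(2)] lv(2)[OF l'(3)] x in blast)+
  qed
  then have "AE t in lebesgue. 0 \<le> t - a \<longrightarrow> v t x = u t x"
    using AE_lebesgue_shift[where a = a and P = "\<lambda>t. 0 \<le> t - a \<longrightarrow> v t x = u t x"] by simp
  then show ?thesis
  proof eventually_elim
    case (elim t)
    show ?case
    proof
      assume "0 \<le> t"
      show "v t x = u t x"
      proof (cases "t \<le> a")
        case True
        then show ?thesis using u v x \<open>0 \<le> t\<close> by (simp add: delayed_solution_def)
      next
        case False
        then show ?thesis using elim by simp
      qed
    qed
  qed
qed

section \<open>The subdiffusive call price\<close>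

text \<open>
  The price as a function of the time \<open>t\<close> to maturity, of the forward price \<open>x\<close> and of the time \<open>a\<close>
  until the stock wakes up.
\<close>

definition subdiffusive_call :: "'a measure \<Rightarrow> (real \<Rightarrow> 'a \<Rightarrow> real) \<Rightarrow> real \<Rightarrow> real \<Rightarrow> real \<Rightarrow> real \<Rightarrow> real \<Rightarrow> real" where
  "subdiffusive_call M S K \<sigma> t x a =
     (LINT y:{0..}|distr M borel (inverse_process S (max 0 (t - a))). black_scholes K \<sigma> x y)"

lemma call_value_eq_subdiffusive_call:
  "call_value M S r \<sigma> K T t x a =
     exp (- (r * (T - t))) * subdiffusive_call M S K \<sigma> (T - t) (exp (r * (T - t)) * x) a"
proof -
  have eq: "x * exp (r * (T - t) - \<sigma>\<^sup>2 * y / 2 + \<sigma> * sqrt y * z) =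
      exp (r * (T - t)) * x * exp (- (\<sigma>\<^sup>2 * y / 2) + \<sigma> * sqrt y * z)" for y z
  proof -
    have "r * (T - t) - \<sigma>\<^sup>2 * y / 2 + \<sigma> * sqrt y * z = r * (T - t) + (- (\<sigma>\<^sup>2 * y / 2) + \<sigma> * sqrt y * z)"
      by simp
    then show ?thesis by (simp only: exp_add[of "r * (T - t)"] mult_ac)
  qed
  show ?thesis
    unfolding call_value_def subdiffusive_call_def black_scholes_def eq ..
qed

context strict_subordinator
begin

lemma measurable_inverse_process [measurable]: "inverse_process S t \<in> borel_measurable M"
  using measurable_compose[OF measurable_Pair1'[of t borel M] measurable_inverse_process_pair] by simp

lemma subdiffusive_call_eq_expectation:
  "subdiffusive_call M S K \<sigma> t x a =
     (LINT \<omega>|M. indicator {0..} (inverse_process S (max 0 (t - a)) \<omega>) *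
        black_scholes K \<sigma> x (inverse_process S (max 0 (t - a)) \<omega>))"
  unfolding subdiffusive_call_def set_lebesgue_integral_def by (subst integral_distr) auto

lemma subdiffusive_call_asleep:
  assumes "t \<le> a"
  shows "subdiffusive_call M S K \<sigma> t x a = call_payoff K x"
proof -
  have "subdiffusive_call M S K \<sigma> t x a = (LINT \<omega>|M. call_payoff K x)"
    unfolding subdiffusive_call_eq_expectation
  proof (rule integral_cong_AE)
    show "AE \<omega> in M. indicator {0..} (inverse_process S (max 0 (t - a)) \<omega>) *
        black_scholes K \<sigma> x (inverse_process S (max 0 (t - a)) \<omega>) = call_payoff K x"
      using AE_inverse_process_0 by eventually_elim (use assms in \<open>simp add: black_scholes_0\<close>)
  qed measurable
  then show ?thesis by (simp add: prob_space)
qed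

text \<open>
  The weight \<open>l exp (- l t)\<close> is the density of an exponential time, at which the inverse is exponential
  of rate \<open>\<phi> l\<close>. Fubini's theorem, applied on the product of the exponential law with \<open>M\<close>, also gives
  the existence of the transform.
\<close>

lemma laplace_transform_subdiffusive_call:
  assumes \<sigma>: "0 < \<sigma>" and K: "0 < K" and x: "0 < x" and l: "0 < l"
    and b: "1 < b" "\<sigma>\<^sup>2 / 2 * (b * (b - 1)) = laplace_exponent \<kappa> \<nu> l"
  shows "laplace_transform_exists (\<lambda>t. subdiffusive_call M S K \<sigma> (t + a) x a) l"
    and "laplace_transform (\<lambda>t. subdiffusive_call M S K \<sigma> (t + a) x a) l = resolvent_call b K x / l"
proof -
  interpret E: prob_space "exponential_distribution l"
    by (rule prob_space_exponential_density[OF l])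
  interpret P: pair_prob_space "exponential_distribution l" M ..
  let ?P = "exponential_distribution l \<Otimes>\<^sub>M M"
  let ?L = "\<lambda>(t, \<omega>). inverse_process S t \<omega>"
  let ?f = "\<lambda>y. indicator {0..} y * black_scholes K \<sigma> x y"
  let ?U = "\<lambda>t. subdiffusive_call M S K \<sigma> (t + a) x a"
  let ?W = "\<lambda>t. LINT \<omega>|M. ?f (inverse_process S t \<omega>)"
  have [measurable]: "?L \<in> borel_measurable ?P" by measurable
  have W: "?U t = ?W t" if "0 \<le> t" for t
    using that by (simp add: subdiffusive_call_eq_expectation)
  have "has_bochner_integral (distr ?P borel ?L) ?f (resolvent_call b K x)"
    using black_scholes_exponential_maturity[OF b(1) \<sigma> K x]
    unfolding distr_inverse_process_exponential[OF l] b(2) .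
  then have i: "integrable ?P (\<lambda>p. ?f (?L p))" "(LINT p|?P. ?f (?L p)) = resolvent_call b K x"
    by (auto simp: has_bochner_integral_iff integrable_distr_eq integral_distr)
  have "integrable (exponential_distribution l) ?W" "(LINT t|exponential_distribution l. ?W t) = resolvent_call b K x"
    using P.integrable_fst'[OF i(1)] P.integral_fst'[OF i(1)] i(2) by auto
  moreover have [measurable]: "?W \<in> borel_measurable borel"
    using borel_measurable_integrable[OF calculation(1)] by simp
  ultimately have j: "integrable lborel (\<lambda>t. exponential_density l t * ?W t)"
      "(LINT t|lborel. exponential_density l t * ?W t) = resolvent_call b K x"
    using l by (auto simp: integrable_density integral_density exponential_density_nonneg)
  have eq: "indicator {0..} t *\<^sub>R (exp (- (l * t)) * ?U t) = (exponential_density l t * ?W t) / l" for t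
    using W[of t] l by (auto simp: indicator_def exponential_density_def mult.commute)
  have m: "(\<lambda>t. (exponential_density l t * ?W t) / l) \<in> borel_measurable lborel"
    by measurable
  show "laplace_transform_exists ?U l"
    unfolding laplace_transform_exists_def set_integrable_def eq
    using j(1) integrable_completion[OF m] by simp
  show "laplace_transform ?U l = resolvent_call b K x / l"
    unfolding laplace_transform_def set_lebesgue_integral_def eq
    using j(2) integral_completion[OF m] by simp
qed

lemma delayed_solution_subdiffusive_call:
  assumes \<sigma>: "0 < \<sigma>" and K: "0 < K"
  shows "delayed_solution \<kappa> \<nu> \<sigma> (call_payoff K) a (\<lambda>t x. subdiffusive_call M S K \<sigma> t x a)"
  unfolding delayed_solution_def ivp_solution_def
proof (intro conjI exI[of _ "0::real"] allI impI ballI)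
  fix t x assume "t \<in> {0..a}"
  then show "subdiffusive_call M S K \<sigma> t x a = call_payoff K x"
    by (simp add: subdiffusive_call_asleep)
next
  fix l :: real assume l: "0 < l"
  let ?U = "\<lambda>t x. subdiffusive_call M S K \<sigma> (t + a) x a"
  obtain b where b: "1 < b" "\<sigma>\<^sup>2 / 2 * (b * (b - 1)) = laplace_exponent \<kappa> \<nu> l"
    using euler_root_exists[OF laplace_exponent_pos[OF l] \<sigma>] .
  note U = laplace_transform_subdiffusive_call[OF \<sigma> K _ l b]
  show "laplace_transform_exists (\<lambda>t. ?U t x) l" if "0 < x" for x
    by (rule U(1)[OF that])
  show "linear_growth (\<lambda>x. laplace_transform (\<lambda>t. ?U t x) l)"
    using linear_growth_resolvent_call[OF b(1) K l] by (simp add: linear_growth_def U(2))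
  show "weak_solution \<sigma> (laplace_exponent \<kappa> \<nu> l) (\<lambda>x. laplace_exponent \<kappa> \<nu> l / l * call_payoff K x)
          (\<lambda>x. laplace_transform (\<lambda>t. ?U t x) l)"
    by (rule weak_solution_cong[OF weak_solution_resolvent_call[OF b(1) K l, of \<sigma>, unfolded b(2)]])
       (simp add: U(2))
qed simp

end

theorem theorem5p6:
  fixes M :: "'a measure" and B S Stock :: "real \<Rightarrow> 'a \<Rightarrow> real"
    and \<nu> :: "real measure" and \<kappa> r \<mu> \<sigma> s0 R0 T K :: real
  assumes "prob_space M"
    and "brownian_motion M B"
    and "subordinator M S \<kappa> \<nu>"
    and "indep_processes M B S"
    and "AE \<omega> in M. strict_mono_on {0..} (\<lambda>t. S t \<omega>)"
    and "0 < T" and "0 < K" and "0 < \<sigma>" and "0 \<le> R0" and "R0 < T"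
    and "subdiffusive_stock M B S R0 r \<mu> \<sigma> s0 Stock"
  shows "\<exists>u :: real \<Rightarrow> real \<Rightarrow> real \<Rightarrow> real.
    (\<forall>a\<in>{0..<T}. unique_delayed_solution \<kappa> \<nu> \<sigma> (call_payoff K) a (\<lambda>t x. u t x a)) \<and>
    (\<forall>a\<ge>T. \<forall>t\<in>{0..T}. \<forall>x>0. u t x a = call_payoff K x) \<and>
    (\<forall>t\<in>{0..T}. \<forall>x>0. \<forall>a\<ge>0.
       call_value M S r \<sigma> K T t x a =
       exp (- (r * (T - t))) * u (T - t) (exp (r * (T - t)) * x) a) \<and>
    (AE \<omega> in M. \<forall>t\<in>{0..T}.
       value_process M S R0 r \<sigma> K T Stock t \<omega> =
       exp (- (r * (T - t))) *
         u (T - t) (exp (r * (T - t)) * Stock t \<omega>) (overshoot S R0 t \<omega>))"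
proof -
  interpret prob_space M by fact
  interpret strict_subordinator M S \<kappa> \<nu> by unfold_locales fact+
  have solution: "delayed_solution \<kappa> \<nu> \<sigma> (call_payoff K) a (\<lambda>t x. subdiffusive_call M S K \<sigma> t x a)" for a
    using \<open>0 < \<sigma>\<close> \<open>0 < K\<close> by (rule delayed_solution_subdiffusive_call)
  have payoff: "continuous_on {0<..} (call_payoff K)"
    unfolding call_payoff_def by (intro continuous_intros)
  show ?thesis
  proof (intro exI[of _ "subdiffusive_call M S K \<sigma>"] conjI ballI allI impI)
    show "unique_delayed_solution \<kappa> \<nu> \<sigma> (call_payoff K) a (\<lambda>t x. subdiffusive_call M S K \<sigma> t x a)" for a
      unfolding unique_delayed_solution_def
      using solution delayed_solution_unique[OF \<open>0 < \<sigma>\<close> laplace_exponent_pos payoff solution] by blast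
  qed (auto simp: subdiffusive_call_asleep call_value_eq_subdiffusive_call value_process_def)
qed

end
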